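(* Let $X$ be a continuum with $\mathrm{Sln}(X)<\mathfrak c$. Then $\dim X\le 1$ and $$\mathrm{rim}\text{-}w(X)\le\mathrm{Sln}(X)\le hl(\exp_c(X))\le w(X)\le\mathrm{Sln}(X)^+.$$
   Context: A continuum is a compact connected Hausdorff space; it is non-degenerate if it has more than one point. For a continuum $X$, the Suslinian number is $\mathrm{Sln}(X)=\sup\{|\mathcal C| : \mathcal C \text{ is a disjoint family of non-degenerate subcontinua of } X\}$. $\mathfrak c=2^{\aleph_0}$, and $\kappa^+$ denotes the successor cardinal of $\kappa$. $\dim$ is the covering dimension. $w(X)$ is the weight of $X$, the smallest cardinality of a base of the topology. The rim-weight is $\mathrm{rim}\text{-}w(X)=\min\{\sup_{U\in\mathcal B} w(\partial U):\mathcal B \text{ is a base of the topology of } X\}$, where $\partial U$ is the boundary of $U$. The Lindelöf number $l(Y)$ is the smallest cardinal $\kappa$ such that each open cover of $Y$ contains a subcover of size $\le\kappa$, and $hl(Y)=\sup\{l(A):A\subset Y\}$. The hyperspace $\exp(X)$ is the space of all non-empty closed subsets of $X$ with the Vietoris topology, and $\exp_c(X)$ is its subspace consisting of the subcontinua of $X$ (degenerate ones included). *)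

theory Defs
  imports "HOL-Analysis.Analysis"
begin

unbundle cardinal_syntax

text \<open>
  Cardinals are cardinal orders, compared by \<open>\<le>o\<close> across types, and determined only up to the
  isomorphism \<open>=o\<close>. No cardinal is required to be infinite.
\<close>

definition Min_card :: "'a rel set \<Rightarrow> 'a rel" where
  "Min_card R = (SOME r. r \<in> R \<and> (\<forall>s\<in>R. r \<le>o s))"

definition Sup_card :: "'a rel set \<Rightarrow> 'a rel" where
  "Sup_card R = Min_card {r. Card_order r \<and> (\<forall>s\<in>R. s \<le>o r)}"

lemma Min_card:
  assumes "R \<noteq> {}" and "\<And>r. r \<in> R \<Longrightarrow> Card_order r"
  shows "Min_card R \<in> R" and "s \<in> R \<Longrightarrow> Min_card R \<le>o s"
proof -
  have "\<exists>r\<in>R. \<forall>s\<in>R. r \<le>o s"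
    using exists_minim_Well_order[of R] assms by (auto simp: card_order_on_def)
  then have "Min_card R \<in> R \<and> (\<forall>s\<in>R. Min_card R \<le>o s)"
    unfolding Min_card_def by (rule_tac someI_ex) auto
  then show "Min_card R \<in> R" and "s \<in> R \<Longrightarrow> Min_card R \<le>o s"
    by auto
qed

text \<open>
  The supremum always exists on the carrier type of the given cardinals, and it is the least upper
  bound also among the cardinals on any other type.
\<close>

lemma Sup_card:
  fixes R :: "'a rel set"
  assumes R: "\<And>r. r \<in> R \<Longrightarrow> Card_order r"
  shows "Card_order (Sup_card R)"
    and "r \<in> R \<Longrightarrow> r \<le>o Sup_card R"
    and "\<lbrakk>Card_order (t :: 'b rel); \<And>r. r \<in> R \<Longrightarrow> r \<le>o t\<rbrakk> \<Longrightarrow> Sup_card R \<le>o t"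
proof -
  define B where "B = {r :: 'a rel. Card_order r \<and> (\<forall>s\<in>R. s \<le>o r)}"
  have le_UNIV: "r \<le>o |UNIV :: 'a set|" if "Card_order r" for r :: "'a rel"
    using that card_of_Field_ordIso card_of_mono1[of "Field r" UNIV] ordIso_ordLeq_trans
      ordIso_symmetric by (metis subset_UNIV)
  then have UNIV_B: "|UNIV :: 'a set| \<in> B"
    using R by (auto simp: B_def card_of_Card_order)
  have B_ne: "B \<noteq> {}"
    using UNIV_B by blast
  have B_Card: "r \<in> B \<Longrightarrow> Card_order r" for r
    by (simp add: B_def)
  have eq: "Sup_card R = Min_card B"
    by (simp add: Sup_card_def B_def)
  have S: "Sup_card R \<in> B"
    unfolding eq using Min_card(1)[OF B_ne B_Card] .
  have least: "s \<in> B \<Longrightarrow> Sup_card R \<le>o s" for s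
    unfolding eq using Min_card(2)[OF B_ne B_Card] .
  show "Card_order (Sup_card R)" and "r \<in> R \<Longrightarrow> r \<le>o Sup_card R"
    using S by (auto simp: B_def)
  show "Sup_card R \<le>o t" if t: "Card_order t" and ub: "\<And>r. r \<in> R \<Longrightarrow> r \<le>o t"
    for t :: "'b rel"
  proof (cases "|UNIV :: 'a set| \<le>o t")
    case True
    then show ?thesis
      using least[OF UNIV_B] ordLeq_transitive by blast
  next
    case False
    then have "t \<le>o |UNIV :: 'a set|"
      using t card_of_Card_order[of "UNIV :: 'a set"]
      by (meson Card_order_iff_ordLeq_card_of ordLeq_total card_order_on_def)
    then obtain A :: "'a set" where A: "t =o |A|"
      using internalize_ordLeq[of t "|UNIV :: 'a set|"] t
      by (metis Card_order_ordIso2 card_of_Field_ordIso ordIso_symmetric ordIso_transitive)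
    then have "|A| \<in> B"
      using ub by (auto simp: B_def card_of_Card_order intro: ordLeq_ordIso_trans)
    then show ?thesis
      using least A ordIso_symmetric ordLeq_ordIso_trans by blast
  qed
qed

definition base_of :: "'a topology \<Rightarrow> 'a set set \<Rightarrow> bool" where
  "base_of X \<B> \<longleftrightarrow> openin X = arbitrary union_of (\<lambda>U. U \<in> \<B>)"

definition weight :: "'a topology \<Rightarrow> 'a set rel" where
  "weight X = Min_card {|\<B>| | \<B>. base_of X \<B>}"

definition rim_weight :: "'a topology \<Rightarrow> 'a set rel" where
  "rim_weight X =
     Min_card {Sup_card ((\<lambda>U. weight (subtopology X (X frontier_of U))) ` \<B>) | \<B>. base_of X \<B>}"

definition open_cover :: "'a topology \<Rightarrow> 'a set set \<Rightarrow> bool" where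
  "open_cover X \<U> \<longleftrightarrow> (\<forall>U\<in>\<U>. openin X U) \<and> \<Union>\<U> = topspace X"

definition lindelof_number :: "'a topology \<Rightarrow> 'a set rel" where
  "lindelof_number X =
     Min_card {\<kappa>. Card_order \<kappa> \<and>
       (\<forall>\<U>. open_cover X \<U> \<longrightarrow> (\<exists>\<V>\<subseteq>\<U>. open_cover X \<V> \<and> |\<V>| \<le>o \<kappa>))}"

definition hereditary_lindelof_number :: "'a topology \<Rightarrow> 'a set rel" where
  "hereditary_lindelof_number X =
     Sup_card {lindelof_number (subtopology X A) | A. A \<subseteq> topspace X}"

text \<open>
  Every finite open cover has a finite open refinement of order at most \<open>n\<close>, that is, no point lies
  in more than \<open>n + 1\<close> of its members. For \<open>n = -1\<close> this says that the space is empty.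
\<close>

definition covering_dim_le :: "'a topology \<Rightarrow> int \<Rightarrow> bool" where
  "covering_dim_le X n \<longleftrightarrow>
     (\<forall>\<U>. finite \<U> \<and> open_cover X \<U> \<longrightarrow>
        (\<exists>\<V>. finite \<V> \<and> open_cover X \<V> \<and> (\<forall>V\<in>\<V>. \<exists>U\<in>\<U>. V \<subseteq> U) \<and>
             (\<forall>x\<in>topspace X. int (card {V\<in>\<V>. x \<in> V}) \<le> n + 1)))"

definition covering_dim :: "'a topology \<Rightarrow> ereal" where
  "covering_dim X = Inf {ereal (of_int n) | n. - 1 \<le> n \<and> covering_dim_le X n}"

definition continuum :: "'a topology \<Rightarrow> bool" where
  "continuum X \<longleftrightarrow> compact_space X \<and> connected_space X \<and> Hausdorff_space X"

definition subcontinuum :: "'a topology \<Rightarrow> 'a set \<Rightarrow> bool" where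
  "subcontinuum X K \<longleftrightarrow> K \<subseteq> topspace X \<and> continuum (subtopology X K)"

definition nondegenerate :: "'a set \<Rightarrow> bool" where
  "nondegenerate K \<longleftrightarrow> (\<exists>x\<in>K. \<exists>y\<in>K. x \<noteq> y)"

definition Sln :: "'a topology \<Rightarrow> 'a set rel" where
  "Sln X = Sup_card {|\<C>| | \<C>. (\<forall>K\<in>\<C>. subcontinuum X K \<and> nondegenerate K) \<and> disjoint \<C>}"

definition exp_carrier :: "'a topology \<Rightarrow> 'a set set" where
  "exp_carrier X = {F. closedin X F \<and> F \<noteq> {}}"

definition exp_space :: "'a topology \<Rightarrow> 'a set topology" where
  "exp_space X = topology_generated_by
     ({{F \<in> exp_carrier X. F \<subseteq> U} | U. openin X U} \<union>
      {{F \<in> exp_carrier X. F \<inter> U \<noteq> {}} | U. openin X U})"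

lemma topspace_exp_space: "topspace (exp_space X) = exp_carrier X"
proof -
  have "exp_carrier X = {F \<in> exp_carrier X. F \<subseteq> topspace X}"
    by (auto simp: exp_carrier_def dest: closedin_subset)
  then show ?thesis
    unfolding exp_space_def topology_generated_by_topspace by blast
qed

definition expc_space :: "'a topology \<Rightarrow> 'a set topology" where
  "expc_space X = subtopology (exp_space X) {K. subcontinuum X K}"

end

theory Submission
  imports Defs
begin

text \<open>
  Boundary bumping makes non-degenerate subcontinua abundant: every non-empty open subset of a
  non-degenerate continuum contains one, and the component of a closed set at an interior point is
  one (\<open>subcontinuum_in_open\<close>, \<open>nondegenerate_component\<close>).  Write \<open>\<kappa>\<close> for the Suslinian number.  It
  bounds every disjoint family of such subcontinua, and most of the estimates come from producing
  families that it has to bound.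

  Dimension and rim-weight.  The fibres of a continuous real function are disjoint, and there are
  \<open>\<cc>\<close> values between 0 and 1; since \<open>\<kappa> < \<cc>\<close>, some such fibre contains no non-degenerate continuum.
  Applied to Urysohn functions, this gives a base of open sets whose frontiers contain none
  (\<open>neighbourhood_with_punctiform_frontier\<close>).  Refine a finite open cover by finitely many sets of
  this base.  The union \<open>F\<close> of their frontiers is totally disconnected, hence covered by finitely many small
  disjoint open sets; what is left of \<open>X\<close> outside \<open>F\<close> is cut by the frontiers into small disjoint
  open sets.  Two disjoint families cover a point at most twice, so \<open>dim X \<le> 1\<close>.

  The bounds on weight rest on \<open>weight_le_of_light\<close>: if a family \<open>\<Phi>\<close> of continuous real functions is
  constant on no non-degenerate continuum through a point of a closed set \<open>S\<close>, then the weight of \<open>S\<close>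
  is at most \<open>\<kappa> \<cdot> |\<Phi>| \<cdot> \<omega>\<close>.  The separating closed sets are the non-degenerate components of the
  rational boxes of \<open>\<Phi>\<close>; each box has at most \<open>\<kappa>\<close> of them.  With a single function and a good fibre this bounds
  the rim-weight.  For the bound \<open>w(X) \<le> \<kappa>\<^sup>+\<close> one takes \<open>\<kappa>\<^sup>+\<close> steps, and at each step adds functions that split
  all non-degenerate components of the fibres of the functions chosen so far, at most \<open>\<kappa>\<close> in number.
  If a non-degenerate continuum stayed in a fibre through all steps, the components
  around it would shrink strictly at each step, and the differences would contain \<open>\<kappa>\<^sup>+\<close>
  disjoint non-degenerate continua (\<open>weight_le_cardSuc_Sln\<close>).

  The bound \<open>\<kappa> \<le> hl(exp\<^sub>c(X))\<close>.  A disjoint family larger than \<open>hl(exp\<^sub>c(X))\<close> has a non-empty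
  part in which every member is approximated by others.  In such a part one can split repeatedly and
  build a binary tree of neighbourhoods, whose branches yield \<open>\<cc>\<close> disjoint
  non-degenerate continua (\<open>subcontinua_of_binary_tree\<close>), contrary to \<open>\<kappa> < \<cc>\<close>.  Finally
  \<open>hl(exp\<^sub>c(X)) \<le> w(X)\<close> because the Vietoris topology has a network built from finite
  subsets of a base of \<open>X\<close>.

  All cardinals in question are infinite once \<open>X\<close> has two points.  If it has not, then \<open>\<kappa> = 0\<close>, and
  the finite values are compared directly.
\<close>

section \<open>Subcontinua and boundary bumping\<close>

lemma subcontinuum_iff:
  assumes "Hausdorff_space X"
  shows "subcontinuum X K \<longleftrightarrow> compactin X K \<and> connectedin X K"
  using assms unfolding subcontinuum_def continuum_def
  by (auto simp: compactin_subspace connectedin_def Hausdorff_space_subtopology)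

lemma continuum_normal: "continuum X \<Longrightarrow> normal_space X"
  unfolding continuum_def using compact_Hausdorff_or_regular_imp_normal_space by blast

lemma subcontinuum_closedin:
  assumes "continuum X" "subcontinuum X K" shows "closedin X K"
  using assms subcontinuum_iff[of X K] by (auto simp: continuum_def compactin_imp_closedin)

lemma subcontinuum_component:
  assumes X: "compact_space X" "Hausdorff_space X" and C: "closedin X C" and x: "x \<in> C"
  shows "subcontinuum X (connected_component_of_set (subtopology X C) x)"
    and "x \<in> connected_component_of_set (subtopology X C) x"
    and "connected_component_of_set (subtopology X C) x \<subseteq> C"
proof -
  let ?K = "connected_component_of_set (subtopology X C) x"
  have CX: "C \<subseteq> topspace X" using C closedin_subset by blast
  show "x \<in> ?K" using x CX by (auto simp: connected_component_of_refl)
  show "?K \<subseteq> C"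
    by (metis connected_component_of_subset_topspace inf.boundedE topspace_subtopology)
  have "closedin X ?K"
    using closedin_connected_component_of[of "subtopology X C" x] C closedin_trans_full by blast
  moreover have "connectedin X ?K"
    using connectedin_connected_component_of[of "subtopology X C" x] connectedin_subtopology by blast
  ultimately show "subcontinuum X ?K"
    using X by (simp add: subcontinuum_iff closedin_compact_space)
qed

text \<open>
  By boundary bumping the component reaches the frontier of \<open>C\<close>, which an interior point avoids.
\<close>

lemma nondegenerate_component:
  assumes X: "continuum X" "nondegenerate (topspace X)" and C: "closedin X C"
    and x: "x \<in> X interior_of C"
  shows "nondegenerate (connected_component_of_set (subtopology X C) x)"
proof (cases "C = topspace X")
  case True
  then have "connected_component_of_set (subtopology X C) x = topspace X"
    using X x connected_space_connected_component_set[of X] 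
    by (auto simp: continuum_def interior_of_subset_topspace[THEN subsetD])
  then show ?thesis using X by simp
next
  case False
  let ?K = "connected_component_of_set (subtopology X C) x"
  have xC: "x \<in> C" using x interior_of_subset by fastforce
  have K: "?K \<in> connected_components_of (subtopology X C)"
    using xC C by (auto simp: connected_component_in_connected_components_of dest: closedin_subset)
  obtain y where "y \<in> ?K" "y \<in> X frontier_of C"
    using boundary_bumping_theorem_closed[OF _ _ _ C False K] X unfolding continuum_def by blast
  then have "y \<noteq> x" using x by (auto simp: frontier_of_def)
  then show ?thesis
    using \<open>y \<in> ?K\<close> subcontinuum_component(2)[OF _ _ C xC] X unfolding nondegenerate_def continuum_def
    by blast
qed

lemma subcontinuum_in_open:
  assumes X: "continuum X" "nondegenerate (topspace X)" and U: "openin X U" "U \<noteq> {}"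
  obtains K where "subcontinuum X K" "nondegenerate K" "K \<subseteq> U"
proof -
  obtain x where x: "x \<in> U" using U by blast
  have "closedin X {x}"
    using X U x by (auto simp: continuum_def closedin_Hausdorff_sing_eq dest: openin_subset)
  then obtain V where V: "openin X V" "{x} \<subseteq> V" "X closure_of V \<subseteq> U"
    using continuum_normal[OF X(1)] U x unfolding normal_space_alt by (metis empty_subsetI insert_subset)
  have int: "x \<in> X interior_of (X closure_of V)"
    using V by (meson closure_of_subset insert_subset interior_of_maximal openin_subset subsetD)
  have cl: "closedin X (X closure_of V)" by simp
  have "x \<in> X closure_of V" using int interior_of_subset by fastforce
  then show thesis
    using that[OF subcontinuum_component(1)[OF _ _ cl] nondegenerate_component[OF X cl int]]
      subcontinuum_component(3)[OF _ _ cl] V X unfolding continuum_def by blast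
qed

lemma subcontinuum_trans:
  assumes "subcontinuum X L" "subcontinuum (subtopology X L) K"
  shows "subcontinuum X K"
  using assms unfolding subcontinuum_def by (auto simp: subtopology_subtopology Int_absorb1)

text \<open>
  How disjoint families are made from nested ones: the difference of two closed sets still
  contains a non-degenerate continuum when the larger one is a non-degenerate continuum.
\<close>

lemma subcontinuum_avoiding:
  assumes X: "continuum X" and L: "subcontinuum X L" "nondegenerate L" and M: "closedin X M" "\<not> L \<subseteq> M"
  obtains K where "subcontinuum X K" "nondegenerate K" "K \<subseteq> L" "K \<inter> M = {}"
proof -
  have "L \<subseteq> topspace X" using L by (simp add: subcontinuum_def)
  then have T: "topspace (subtopology X L) = L" by auto
  have "openin (subtopology X L) (L - M)"
    using M \<open>L \<subseteq> topspace X\<close> unfolding openin_subtopology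
    by (intro exI[of _ "topspace X - M"]) (auto simp: closedin_def)
  then obtain K where "subcontinuum (subtopology X L) K" "nondegenerate K" "K \<subseteq> L - M"
    using subcontinuum_in_open[of "subtopology X L" "L - M"] L M T unfolding subcontinuum_def by auto
  then show thesis using that subcontinuum_trans[OF L(1)] by blast
qed

lemma directed_finite_subset:
  assumes "\<F> \<noteq> {}" and "\<And>C D. C \<in> \<F> \<Longrightarrow> D \<in> \<F> \<Longrightarrow> \<exists>E\<in>\<F>. E \<subseteq> C \<inter> D" and "finite \<G>" "\<G> \<subseteq> \<F>"
  shows "\<exists>E\<in>\<F>. E \<subseteq> \<Inter>\<G>"
  using assms(3,4)
proof (induction \<G>)
  case empty then show ?case using assms(1) by auto
next
  case (insert C \<G>)
  then obtain E where "E \<in> \<F>" "E \<subseteq> \<Inter>\<G>" by auto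
  then obtain E' where "E' \<in> \<F>" "E' \<subseteq> C \<inter> E" using assms(2) insert.prems by blast
  then show ?case using \<open>E \<subseteq> \<Inter>\<G>\<close> by blast
qed

lemma directed_Inter_subset_open:
  assumes X: "compact_space X" and ne: "\<F> \<noteq> {}" and cl: "\<And>C. C \<in> \<F> \<Longrightarrow> closedin X C"
    and dir: "\<And>C D. C \<in> \<F> \<Longrightarrow> D \<in> \<F> \<Longrightarrow> \<exists>E\<in>\<F>. E \<subseteq> C \<inter> D"
    and W: "openin X W" "\<Inter>\<F> \<subseteq> W"
  shows "\<exists>C\<in>\<F>. C \<subseteq> W"
proof (rule ccontr)
  assume neg: "\<not> ?thesis"
  let ?\<U> = "(\<lambda>C. C - W) ` \<F>"
  have "\<forall>C\<in>?\<U>. closedin X C" using cl W by (auto intro: closedin_diff)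
  moreover have "\<Inter>\<G> \<noteq> {}" if fin: "finite \<G>" "\<G> \<subseteq> ?\<U>" for \<G>
  proof -
    obtain \<G>' where "finite \<G>'" "\<G>' \<subseteq> \<F>" "\<G> = (\<lambda>C. C - W) ` \<G>'"
      using finite_subset_image[OF fin] by blast
    then obtain E where "E \<in> \<F>" "E \<subseteq> \<Inter>\<G>'" using directed_finite_subset[OF ne dir] by metis
    then have "E - W \<subseteq> \<Inter>\<G>" "E - W \<noteq> {}" using neg \<open>\<G> = _\<close> by auto
    then show ?thesis by blast
  qed
  ultimately have "\<Inter>?\<U> \<noteq> {}"
    by (intro X[unfolded compact_space_fip, rule_format]) auto
  then show False using W(2) ne by blast
qed

text \<open>
  In a compact Hausdorff space components are intersections of clopen sets.  If no continuum in the
  intersection joined \<open>A\<close> to \<open>B\<close>, a clopen partition of the intersection would separate them; by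
  compactness the partition extends to one of the sets \<open>C\<close>, and it would cut the connected subset
  of \<open>C\<close> that joins \<open>A\<close> to \<open>B\<close>.
\<close>

lemma directed_Inter_subcontinuum:
  assumes X: "compact_space X" "Hausdorff_space X" and ne: "\<F> \<noteq> {}" and cl: "\<And>C. C \<in> \<F> \<Longrightarrow> closedin X C"
    and dir: "\<And>C D. C \<in> \<F> \<Longrightarrow> D \<in> \<F> \<Longrightarrow> \<exists>E\<in>\<F>. E \<subseteq> C \<inter> D"
    and A: "closedin X A" and B: "closedin X B"
    and K: "\<And>C. C \<in> \<F> \<Longrightarrow> \<exists>K. connectedin X K \<and> K \<subseteq> C \<and> K \<inter> A \<noteq> {} \<and> K \<inter> B \<noteq> {}"
  obtains K where "subcontinuum X K" "K \<subseteq> \<Inter>\<F>" "K \<inter> A \<noteq> {}" "K \<inter> B \<noteq> {}"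
proof -
  let ?Z = "\<Inter>\<F>" let ?Y = "subtopology X ?Z"
  have Z: "closedin X ?Z" using cl ne by blast
  then have ZX: "?Z \<subseteq> topspace X" using closedin_subset by blast
  have "\<exists>C. connectedin ?Y C \<and> C \<inter> A \<noteq> {} \<and> C \<inter> B \<noteq> {}"
  proof (rule ccontr)
    assume "\<not> ?thesis"
    then have "separated_between ?Y (?Z \<inter> A) (?Z \<inter> B)"
      using X Z A B 
      by (intro cut_wire_fence_theorem)
         (auto simp: disjnt_def connectedin_subtopology closedin_compact_space compact_space_subtopology
           Hausdorff_space_subtopology intro!: closedin_subtopology_Int_closed)
    then obtain P Q where PQ: "closedin ?Y P" "closedin ?Y Q" "P \<union> Q = topspace ?Y"
      "disjnt P Q" "?Z \<inter> A \<subseteq> P" "?Z \<inter> B \<subseteq> Q"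
      unfolding separated_between_alt by auto
    then have PQX: "closedin X P" "closedin X Q" using Z closedin_trans_full by blast+
    obtain U V where UV: "openin X U" "openin X V" "P \<subseteq> U" "Q \<subseteq> V" "disjnt U V"
      using compact_Hausdorff_or_regular_imp_normal_space[OF X(1)] X(2) PQX PQ(4)
      unfolding normal_space_def by metis
    \<comment> \<open>Removing \<open>B\<close> and \<open>A\<close> loses no point of the intersection and makes a connected set
        that meets both \<open>A\<close> and \<open>B\<close> meet both parts.\<close>
    let ?W = "(U - B) \<union> (V - A)"
    have op: "openin X (U - B)" "openin X (V - A)" using UV A B by (auto intro: openin_diff)
    have "?Z \<subseteq> P \<union> Q" "P \<inter> Q = {}" using PQ ZX by (auto simp: disjnt_def)
    then have "?Z \<subseteq> ?W" using PQ(5,6) UV by blast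
    then obtain C where C: "C \<in> \<F>" "C \<subseteq> ?W"
      using directed_Inter_subset_open[OF X(1) ne cl dir _] op by (metis openin_Un)
    obtain K where "connectedin X K" "K \<subseteq> C" "K \<inter> A \<noteq> {}" "K \<inter> B \<noteq> {}" using K[OF C(1)] by metis
    moreover have "\<not> connectedin X K"
    proof -
      have "K \<subseteq> (U - B) \<union> (V - A)" using C(2) \<open>K \<subseteq> C\<close> by (rule order_trans[rotated])
      moreover have "(U - B) \<inter> (V - A) \<inter> K = {}" using UV(5) unfolding disjnt_def by blast
      moreover have "(U - B) \<inter> K \<noteq> {}" "(V - A) \<inter> K \<noteq> {}"
        using calculation(1) \<open>K \<inter> A \<noteq> {}\<close> \<open>K \<inter> B \<noteq> {}\<close> by blast+
      ultimately show ?thesis unfolding connectedin using op by metis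
    qed
    ultimately show False by blast
  qed
  then obtain C a b where C: "connectedin ?Y C" "a \<in> C" "a \<in> A" "b \<in> C" "b \<in> B" by blast
  then have "a \<in> ?Z" "b \<in> connected_component_of_set ?Y a"
    using connectedin_subset_topspace[of ?Y C] by (auto simp: connected_component_of_def)
  then show thesis
    using that subcontinuum_component[OF X Z, of a] C by blast
qed

section \<open>Cardinal bounds\<close>

lemma card_of_Times_bound:
  assumes "Cinfinite c" "|A| \<le>o c" "|B| \<le>o c" shows "|A \<times> B| \<le>o c"
  using card_of_Times_ordLeq_infinite_Field[of c A B] assms by (simp add: cinfinite_def)

lemma card_of_image_bound: "|A| \<le>o c \<Longrightarrow> |f ` A| \<le>o c"
  by (rule ordLeq_transitive[OF card_of_image])

lemma card_of_subset_bound: "|B| \<le>o c \<Longrightarrow> A \<subseteq> B \<Longrightarrow> |A| \<le>o c"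
  by (rule ordLeq_transitive[OF card_of_mono1])

lemma card_of_countable_bound:
  assumes "Cinfinite c" "countable A" shows "|A| \<le>o c"
proof -
  have "|A| \<le>o |UNIV::nat set|" using assms(2) unfolding countable_def card_of_ordLeq[symmetric] by blast
  also have "|UNIV::nat set| \<le>o c"
    by (rule ordIso_ordLeq_trans[OF card_of_nat natLeq_ordLeq_cinfinite[OF assms(1)]])
  finally show ?thesis .
qed

text \<open>
  Induction on a bound for the size of the finite sets: a set of size at most \<open>n + 1\<close> arises
  from one of size at most \<open>n\<close> by inserting one element.
\<close>

lemma card_of_Fpow_bound:
  fixes A :: "'a set"
  assumes c: "Cinfinite c" and A: "|A| \<le>o c"
  shows "|Fpow A| \<le>o c"
proof -
  define F where "F n = {S. S \<subseteq> A \<and> finite S \<and> card S \<le> n}" for n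
  have one: "|{{} :: 'a set}| \<le>o c" using c by (intro card_of_countable_bound) auto
  have "|F n| \<le>o c" for n
  proof (induction n)
    case 0
    have "F 0 \<subseteq> {{}}" by (auto simp: F_def)
    then show ?case by (rule card_of_subset_bound[OF one])
  next
    case (Suc n)
    have "F (Suc n) \<subseteq> {{}} \<union> (\<lambda>(a,S). insert a S) ` (A \<times> F n)"
    proof
      fix S assume S: "S \<in> F (Suc n)"
      show "S \<in> {{}} \<union> (\<lambda>(a,S). insert a S) ` (A \<times> F n)"
      proof (cases "S = {}")
        case False
        then obtain a where a: "a \<in> S" by auto
        then have "(a, S - {a}) \<in> A \<times> F n" using S by (auto simp: F_def card_Diff_singleton)
        moreover have "S = insert a (S - {a})" using a by auto
        ultimately have "S \<in> (\<lambda>(a,S). insert a S) ` (A \<times> F n)" by (intro rev_image_eqI) auto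
        then show ?thesis by simp
      qed simp
    qed
    moreover have "|{{}} \<union> (\<lambda>(a,S). insert a S) ` (A \<times> F n)| \<le>o c"
      by (intro Un_Cinfinite_bound one card_of_image_bound card_of_Times_bound c A Suc)
    ultimately show ?case by (rule card_of_subset_bound[rotated])
  qed
  then have "|\<Union>n\<in>UNIV. F n| \<le>o c"
    using c by (intro UNION_Cinfinite_bound card_of_countable_bound) auto
  moreover have "Fpow A \<subseteq> (\<Union>n\<in>UNIV. F n)" by (auto simp: Fpow_def F_def)
  ultimately show ?thesis by (rule card_of_subset_bound)
qed

lemma continuum_eq_card_of_functions: "|UNIV :: (nat \<Rightarrow> bool) set| =o ctwo ^c natLeq"
proof -
  have "ctwo ^c natLeq = |UNIV :: (nat \<Rightarrow> bool) set|"
    by (simp add: cexp_def ctwo_def Field_card_of Func_def Field_natLeq)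
  then show ?thesis by (simp add: ordIso_refl card_of_Card_order)
qed

lemma continuum_le_card_of_unit_interval: "ctwo ^c natLeq \<le>o |{0<..<1::real}|"
proof -
  have "(UNIV::nat set set) \<lesssim> {0<..<1::real}"
    using nat_sets_eqpoll_reals open_interval_eqpoll_reals[of 0 "1::real"] 
    by (meson eqpoll_imp_lepoll eqpoll_sym lepoll_trans zero_less_one)
  then have "|UNIV::nat set set| \<le>o |{0<..<1::real}|"
    unfolding lepoll_def card_of_ordLeq[symmetric] by blast
  moreover have "|UNIV :: (nat \<Rightarrow> bool) set| \<le>o |UNIV::nat set set|"
    unfolding card_of_ordLeq[symmetric] by (intro exI[of _ Collect]) (auto simp: inj_on_def)
  ultimately show ?thesis
    by (meson continuum_eq_card_of_functions ordIso_symmetric ordIso_ordLeq_trans ordLeq_transitive)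
qed

section \<open>The Suslinian number\<close>

lemma Card_order_Sln: "Card_order (Sln X)"
  unfolding Sln_def by (rule Sup_card) (auto simp: card_of_Card_order)

lemma card_of_le_Sln:
  assumes "\<And>K. K \<in> \<C> \<Longrightarrow> subcontinuum X K" "\<And>K. K \<in> \<C> \<Longrightarrow> nondegenerate K" "disjoint \<C>"
  shows "|\<C>| \<le>o Sln X"
  unfolding Sln_def using assms by (intro Sup_card(2)) (auto simp: card_of_Card_order)

lemma Sln_least:
  assumes "Card_order c"
    and "\<And>\<C>. (\<forall>K\<in>\<C>. subcontinuum X K \<and> nondegenerate K) \<Longrightarrow> disjoint \<C> \<Longrightarrow> |\<C>| \<le>o c"
  shows "Sln X \<le>o c"
  unfolding Sln_def using assms by (intro Sup_card(3)) (auto simp: card_of_Card_order)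

lemma card_of_index_le_Sln:
  assumes K: "\<And>i. i \<in> I \<Longrightarrow> subcontinuum X (K i)" "\<And>i. i \<in> I \<Longrightarrow> nondegenerate (K i)"
    and dis: "\<And>i j. i \<in> I \<Longrightarrow> j \<in> I \<Longrightarrow> i \<noteq> j \<Longrightarrow> K i \<inter> K j = {}"
  shows "|I| \<le>o Sln X"
proof -
  have "inj_on K I"
  proof (rule inj_onI)
    fix i j assume ij: "i \<in> I" "j \<in> I" "K i = K j"
    have "K i \<noteq> {}" using K(2)[OF ij(1)] by (auto simp: nondegenerate_def)
    then show "i = j" using dis[OF ij(1,2)] ij(3) by auto
  qed
  then have "|I| \<le>o |K ` I|" unfolding card_of_ordLeq[symmetric] by blast
  moreover have "|K ` I| \<le>o Sln X"
  proof (rule card_of_le_Sln)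
    show "disjoint (K ` I)" unfolding disjoint_def using dis by (metis imageE)
  qed (use K in blast)+
  ultimately show ?thesis by (rule ordLeq_transitive)
qed

section \<open>Weight and rim-weight\<close>

lemma base_of_iff:
  "base_of X \<B> \<longleftrightarrow> (\<forall>B\<in>\<B>. openin X B) \<and> (\<forall>U x. openin X U \<longrightarrow> x \<in> U \<longrightarrow> (\<exists>B\<in>\<B>. x \<in> B \<and> B \<subseteq> U))"
  (is "?l \<longleftrightarrow> ?r")
proof
  assume l: ?l
  then have "openin X U \<longleftrightarrow> (\<exists>\<U>. \<U> \<subseteq> \<B> \<and> \<Union>\<U> = U)" for U
    unfolding base_of_def union_of_def arbitrary_def by (auto simp: subset_eq fun_eq_iff)
  note iff = this
  show ?r
  proof (intro conjI ballI allI impI)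
    fix B assume "B \<in> \<B>"
    then show "openin X B" using iff[of B] by (intro iff[THEN iffD2] exI[of _ "{B}"]) auto
  next
    fix U x assume "openin X U" "x \<in> U"
    then obtain \<U> where "\<U> \<subseteq> \<B>" "\<Union>\<U> = U" using iff by auto
    then show "\<exists>B\<in>\<B>. x \<in> B \<and> B \<subseteq> U" using \<open>x \<in> U\<close> by auto
  qed
next
  assume r: ?r
  have "openin X U \<longleftrightarrow> (\<exists>\<U>. \<U> \<subseteq> \<B> \<and> \<Union>\<U> = U)" for U
  proof
    assume "openin X U"
    then have "\<exists>B\<in>\<B>. x \<in> B \<and> B \<subseteq> U" if "x \<in> U" for x using r that by auto
    then have "\<Union>{B \<in> \<B>. B \<subseteq> U} = U" by blast
    then show "\<exists>\<U>. \<U> \<subseteq> \<B> \<and> \<Union>\<U> = U" by (intro exI[of _ "{B \<in> \<B>. B \<subseteq> U}"]) auto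
  qed (use r in \<open>auto intro!: openin_Union\<close>)
  then show ?l unfolding base_of_def union_of_def arbitrary_def by (auto simp: subset_eq fun_eq_iff)
qed

lemma base_of_openin: "base_of X {U. openin X U}"
  by (auto simp: base_of_iff)

lemma weight_le: "base_of X \<B> \<Longrightarrow> weight X \<le>o |\<B>|"
  unfolding weight_def by (rule Min_card(2)) (auto simp: card_of_Card_order)

lemma weight_base: obtains \<B> where "base_of X \<B>" "weight X = |\<B>|"
proof -
  have "weight X \<in> {|\<B>| | \<B>. base_of X \<B>}"
    unfolding weight_def using base_of_openin[of X] by (intro Min_card(1)) (auto simp: card_of_Card_order)
  then show thesis using that by auto
qed

lemma Card_order_weight: "Card_order (weight X)"
  by (rule weight_base[of X]) (simp add: card_of_Card_order del: Field_card_of)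

lemma rim_weight_le:
  fixes X :: "'a topology"
  assumes B: "base_of X \<B>" and w: "\<And>V. V \<in> \<B> \<Longrightarrow> weight (subtopology X (X frontier_of V)) \<le>o c"
    and c: "Card_order c"
  shows "rim_weight X \<le>o c"
proof -
  let ?w = "\<lambda>U. weight (subtopology X (X frontier_of U))"
  let ?R = "{Sup_card (?w ` \<B>) | \<B>. base_of X \<B>}"
  have "rim_weight X \<le>o Sup_card (?w ` \<B>)"
    unfolding rim_weight_def
  proof (rule Min_card(2))
    show "?R \<noteq> {}" "Sup_card (?w ` \<B>) \<in> ?R" using B by auto
    show "Card_order r" if "r \<in> ?R" for r
      using that by (auto intro!: Sup_card(1) Card_order_weight)
  qed
  also have "Sup_card (?w ` \<B>) \<le>o c"
    by (rule Sup_card(3)[OF _ c]) (use w Card_order_weight in auto)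
  finally show ?thesis .
qed

text \<open>
  Separating the disjoint members of \<open>\<D>\<close> by open sets gives few open sets that
  distinguish points in the sense of Hausdorff.  On a compact space the Hausdorff topology that they
  generate cannot be strictly coarser than the given one; the base consists of their finite
  intersections.
\<close>

lemma weight_closed_subset_le:
  assumes X: "compact_space X" "Hausdorff_space X" and S: "closedin X S"
    and \<D>: "\<And>D. D \<in> \<D> \<Longrightarrow> closedin X D"
    and sep: "\<And>x y. x \<in> S \<Longrightarrow> y \<in> S \<Longrightarrow> x \<noteq> y \<Longrightarrow> \<exists>D\<in>\<D>. \<exists>E\<in>\<D>. x \<in> D \<and> y \<in> E \<and> D \<inter> E = {}"
    and c: "Cinfinite c" "|\<D>| \<le>o c"
  shows "weight (subtopology X S) \<le>o c"
proof -
  have "\<exists>U V. openin X U \<and> openin X V \<and> (D \<inter> E = {} \<longrightarrow> D \<subseteq> U \<and> E \<subseteq> V \<and> U \<inter> V = {})"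
    if "D \<in> \<D>" "E \<in> \<D>" for D E
    using compact_Hausdorff_or_regular_imp_normal_space[OF X(1)] X(2) \<D>[OF that(1)] \<D>[OF that(2)]
    unfolding normal_space_def disjnt_def by (metis openin_empty)
  then obtain u v where uv: "\<And>D E. D \<in> \<D> \<Longrightarrow> E \<in> \<D> \<Longrightarrow> openin X (u D E) \<and> openin X (v D E) \<and>
      (D \<inter> E = {} \<longrightarrow> D \<subseteq> u D E \<and> E \<subseteq> v D E \<and> u D E \<inter> v D E = {})" by metis
  define \<O> where "\<O> = (\<lambda>(D,E). u D E) ` (\<D> \<times> \<D>)"
  define \<B> where "\<B> = (\<lambda>\<P>. S \<inter> \<Inter>\<P>) ` Fpow \<O>"
  have op: "openin X P" if "P \<in> \<O>" for P using that uv by (auto simp: \<O>_def)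
  have "|\<O>| \<le>o c" unfolding \<O>_def by (intro card_of_image_bound card_of_Times_bound c)
  then have B: "|\<B>| \<le>o c" unfolding \<B>_def by (intro card_of_image_bound card_of_Fpow_bound c)
  have "base_of (subtopology X S) \<B>"
    unfolding base_of_iff
  proof (intro conjI ballI allI impI)
    fix B assume "B \<in> \<B>"
    then obtain \<P> where P: "B = S \<inter> \<Inter>\<P>" "finite \<P>" "\<P> \<subseteq> \<O>" by (auto simp: \<B>_def Fpow_def)
    have "openin (subtopology X S) (S \<inter> (topspace X \<inter> \<Inter>\<P>))"
      using P op openin_Int_Inter[of \<P> X "topspace X"] by (blast intro: openin_subtopology_Int2)
    moreover have "S \<inter> (topspace X \<inter> \<Inter>\<P>) = B" using P S closedin_subset by blast
    ultimately show "openin (subtopology X S) B" by simp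
  next
    fix U x assume U: "openin (subtopology X S) U" and x: "x \<in> U"
    have SX: "S \<subseteq> topspace X" using S closedin_subset by blast
    have xS: "x \<in> S" using U x openin_subset by fastforce
    have "closedin (subtopology X S) (S - U)"
      using U SX by (metis closedin_diff closedin_topspace topspace_subtopology_subset)
    then have "closedin X (S - U)" using S closedin_trans_full by blast
    then have comp: "compactin X (S - U)" using X closedin_compact_space by blast
    have "\<exists>P Q. P \<in> \<O> \<and> openin X Q \<and> x \<in> P \<and> y \<in> Q \<and> P \<inter> Q = {}" if y: "y \<in> S - U" for y
    proof -
      have "y \<noteq> x" using y x by blast
      then obtain D E where DE: "D \<in> \<D>" "E \<in> \<D>" "x \<in> D" "y \<in> E" "D \<inter> E = {}" using sep xS y by blast
      then have "u D E \<in> \<O>" by (auto simp: \<O>_def)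
      then show ?thesis using uv[OF DE(1,2)] DE by blast
    qed
    then obtain p q where pq: "\<And>y. y \<in> S - U \<Longrightarrow> p y \<in> \<O> \<and> openin X (q y) \<and> x \<in> p y \<and> y \<in> q y \<and> p y \<inter> q y = {}"
      by metis
    have "\<exists>\<F>. finite \<F> \<and> \<F> \<subseteq> q ` (S - U) \<and> S - U \<subseteq> \<Union>\<F>"
      using pq by (intro compactinD[OF comp]) auto
    then obtain Y where Y: "finite Y" "Y \<subseteq> S - U" "S - U \<subseteq> \<Union>(q ` Y)"
      by (metis finite_subset_image)
    have "S \<inter> \<Inter>(p ` Y) \<in> \<B>" using Y pq by (auto simp: \<B>_def Fpow_def)
    moreover have "x \<in> S \<inter> \<Inter>(p ` Y)" using xS Y pq by auto
    moreover have "S \<inter> \<Inter>(p ` Y) \<subseteq> U"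
    proof
      fix z assume z: "z \<in> S \<inter> \<Inter>(p ` Y)"
      show "z \<in> U"
      proof (rule ccontr)
        assume "z \<notin> U"
        then obtain y where "y \<in> Y" "z \<in> q y" using z Y(3) by blast
        then show False using pq[of y] z Y(2) by blast
      qed
    qed
    ultimately show "\<exists>B\<in>\<B>. x \<in> B \<and> B \<subseteq> U" by blast
  qed
  then show ?thesis by (rule ordLeq_transitive[OF weight_le B])
qed

section \<open>Infinitude of the invariants\<close>

lemma continuum_surjects_unit_interval:
  assumes X: "continuum X" and A: "closedin X A" "A \<noteq> {}" and B: "closedin X B" "B \<noteq> {}" and dis: "disjnt A B"
  obtains f where "continuous_map X euclideanreal f" "f ` A \<subseteq> {0}" "f ` B \<subseteq> {1}" "{0..1} \<subseteq> f ` topspace X"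
proof -
  obtain f where f: "continuous_map X euclideanreal f" "f ` A \<subseteq> {0}" "f ` B \<subseteq> {1}"
    using Urysohn_lemma_alt[OF continuum_normal[OF X] A(1) B(1) dis] by metis
  have "connectedin euclideanreal (f ` topspace X)"
    using connectedin_continuous_map_image[OF f(1)] X by (simp add: continuum_def connectedin_topspace)
  then have "connected (f ` topspace X)" by simp
  moreover have "0 \<in> f ` topspace X" "1 \<in> f ` topspace X"
    using f A B closedin_subset[OF A(1)] closedin_subset[OF B(1)] by (auto simp: subset_iff image_iff)+
  ultimately have "{0..1} \<subseteq> f ` topspace X" by (rule connected_contains_Icc)
  then show thesis using that f by metis
qed

text \<open>
  The preimages of disjoint intervals under a map onto \<open>[0, 1]\<close>.
\<close>

lemma infinitely_many_disjoint_open: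
  assumes X: "continuum X" "nondegenerate (topspace X)"
  obtains U :: "nat \<Rightarrow> 'a set" where "\<And>n. openin X (U n)" "\<And>n. U n \<noteq> {}" "\<And>m n. m \<noteq> n \<Longrightarrow> U m \<inter> U n = {}"
proof -
  obtain x y where xy: "x \<in> topspace X" "y \<in> topspace X" "x \<noteq> y" using X by (auto simp: nondegenerate_def)
  have cl: "closedin X {x}" "closedin X {y}" using X xy by (auto simp: continuum_def closedin_Hausdorff_sing_eq)
  obtain f where f: "continuous_map X euclideanreal f" "{0..1} \<subseteq> f ` topspace X"
    using continuum_surjects_unit_interval[OF X(1) cl(1) _ cl(2)] xy by (metis disjnt_insert1 disjnt_empty1 insert_not_empty singletonD)
  define J where "J n = {1 / (real n + 2)<..<1 / (real n + 1)}" for n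
  define U where "U n = {z \<in> topspace X. f z \<in> J n}" for n
  have "openin X (U n)" for n
    unfolding U_def J_def by (intro openin_continuous_map_preimage[OF f(1)]) auto
  moreover have "U n \<noteq> {}" for n
  proof -
    have "1 / (real n + 2) < 1 / (real n + 1)" by (simp add: field_simps)
    then obtain t where t: "1 / (real n + 2) < t" "t < 1 / (real n + 1)" using dense by blast
    moreover have "0 < 1 / (real n + 2)" "1 / (real n + 1) \<le> 1" by auto
    ultimately have "t \<in> {0..1}" unfolding atLeastAtMost_iff by linarith
    then have "t \<in> f ` topspace X" using f(2) by (rule subsetD[rotated])
    then show ?thesis using t by (auto simp: U_def J_def)
  qed
  moreover have "U m \<inter> U n = {}" if "m \<noteq> n" for m n
  proof -
    have "J m \<inter> J n = {}" if "m < n" for m n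
    proof -
      have "1 / (real n + 1) \<le> 1 / (real m + 2)" using that by (intro divide_left_mono) auto
      then show ?thesis by (auto simp: J_def)
    qed
    then have "J m \<inter> J n = {}" using that by (metis Int_commute linorder_neqE_nat)
    then show ?thesis by (auto simp: U_def)
  qed
  ultimately show thesis using that by metis
qed

lemma Cinfinite_Sln:
  assumes X: "continuum X" "nondegenerate (topspace X)"
  shows "Cinfinite (Sln X)"
proof -
  obtain U :: "nat \<Rightarrow> 'a set" where U: "\<And>n. openin X (U n)" "\<And>n. U n \<noteq> {}" "\<And>m n. m \<noteq> n \<Longrightarrow> U m \<inter> U n = {}"
    using infinitely_many_disjoint_open[OF X] by metis
  have "\<exists>K. subcontinuum X K \<and> nondegenerate K \<and> K \<subseteq> U n" for n
    using subcontinuum_in_open[OF X U(1,2)] by metis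
  then obtain K where K: "\<And>n. subcontinuum X (K n) \<and> nondegenerate (K n) \<and> K n \<subseteq> U n" by metis
  have "|UNIV::nat set| \<le>o Sln X"
  proof (rule card_of_index_le_Sln)
    show "K m \<inter> K n = {}" if "m \<noteq> n" for m n using K[of m] K[of n] U(3)[OF that] by auto
  qed (use K in auto)
  then have "natLeq \<le>o Sln X" by (rule ordIso_ordLeq_trans[OF ordIso_symmetric[OF card_of_nat]])
  then show ?thesis using Card_order_Sln cinfinite_mono natLeq_cinfinite by auto
qed

lemma Cinfinite_weight:
  assumes X: "continuum X" "nondegenerate (topspace X)"
  shows "Cinfinite (weight X)"
proof -
  obtain U :: "nat \<Rightarrow> 'a set" where U: "\<And>n. openin X (U n)" "\<And>n. U n \<noteq> {}" "\<And>m n. m \<noteq> n \<Longrightarrow> U m \<inter> U n = {}"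
    using infinitely_many_disjoint_open[OF X] by metis
  obtain \<B> where B: "base_of X \<B>" "weight X = |\<B>|" by (rule weight_base)
  have "\<exists>b\<in>\<B>. b \<noteq> {} \<and> b \<subseteq> U n" for n
    using B(1) U(1)[of n] U(2)[of n] unfolding base_of_iff by (metis all_not_in_conv)
  then obtain b where b: "\<And>n. b n \<in> \<B> \<and> b n \<noteq> {} \<and> b n \<subseteq> U n" by metis
  have "inj b"
  proof (rule injI, rule ccontr)
    fix m n assume "b m = b n" "m \<noteq> n"
    then have "b m \<subseteq> U m \<inter> U n" using b[of m] b[of n] by auto
    then show False using U(3)[OF \<open>m \<noteq> n\<close>] b[of m] by auto
  qed
  then have "infinite \<B>" using b infinite_iff_countable_subset[of \<B>] by auto
  then show ?thesis using B by (simp add: cinfinite_def Field_card_of card_of_card_order_on)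
qed

section \<open>Trees of subcontinua\<close>

text \<open>
  Each \<open>K\<close> in \<open>\<H>\<close> has another member of \<open>\<H>\<close> in every neighbourhood, so a neighbourhood of a
  member can be split into neighbourhoods of two members with disjoint closures.  Along a branch \<open>b\<close>
  the closures decrease, and each contains a continuum joining \<open>A\<close> to \<open>B\<close>; so does their
  intersection.  Fixing \<open>A\<close> and \<open>B\<close> in advance is what keeps the continua \<open>L b\<close> from degenerating.
\<close>

lemma subcontinua_of_binary_tree:
  assumes X: "compact_space X" "Hausdorff_space X"
    and A: "closedin X A" and B: "closedin X B" and AB: "A \<inter> B = {}"
    and ne: "\<H> \<noteq> {}" and dis: "disjoint \<H>" and sub: "\<And>K. K \<in> \<H> \<Longrightarrow> subcontinuum X K"
    and meet: "\<And>K. K \<in> \<H> \<Longrightarrow> K \<inter> A \<noteq> {} \<and> K \<inter> B \<noteq> {}"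
    and crowded: "\<And>K U. K \<in> \<H> \<Longrightarrow> openin X U \<Longrightarrow> K \<subseteq> U \<Longrightarrow> \<exists>K'\<in>\<H>. K' \<noteq> K \<and> K' \<subseteq> U"
  obtains L :: "(nat \<Rightarrow> bool) \<Rightarrow> 'a set" where "\<And>b. subcontinuum X (L b)" "\<And>b. nondegenerate (L b)"
    "\<And>b c. b \<noteq> c \<Longrightarrow> L b \<inter> L c = {}"
proof -
  have cl: "closedin X K" if "K \<in> \<H>" for K
    using sub[OF that] X by (simp add: subcontinuum_iff compactin_imp_closedin)
  define good where "good p \<longleftrightarrow> fst p \<in> \<H> \<and> openin X (snd p) \<and> fst p \<subseteq> snd p" for p :: "'a set \<times> 'a set"
  have "\<exists>q r. good q \<and> good r \<and> snd q \<subseteq> snd p \<and> snd r \<subseteq> snd p \<and>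
      disjnt (X closure_of snd q) (X closure_of snd r)" if p: "good p" for p
  proof -
    obtain K' where K': "K' \<in> \<H>" "K' \<noteq> fst p" "K' \<subseteq> snd p" using crowded p by (metis good_def)
    have "disjnt (fst p) K'" using dis p K' by (auto simp: good_def pairwise_def)
    then obtain U V where UV: "openin X U" "openin X V" "fst p \<subseteq> U" "K' \<subseteq> V" "disjnt (X closure_of U) (X closure_of V)"
      using compact_Hausdorff_or_regular_imp_normal_space[OF X(1)] X(2) cl K'(1) p
      unfolding normal_space_disjoint_closures good_def by metis
    have "disjnt (X closure_of (U \<inter> snd p)) (X closure_of (V \<inter> snd p))"
      using UV(5) by (rule disjnt_subset1[OF disjnt_subset2]) (auto intro!: closure_of_mono)
    then show ?thesis using p K' UV
      by (intro exI[of _ "(fst p, U \<inter> snd p)"] exI[of _ "(K', V \<inter> snd p)"]) (auto simp: good_def)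
  qed
  then obtain s0 s1 where s: "\<And>p. good p \<Longrightarrow> good (s0 p) \<and> good (s1 p) \<and> snd (s0 p) \<subseteq> snd p \<and> snd (s1 p) \<subseteq> snd p \<and>
      disjnt (X closure_of snd (s0 p)) (X closure_of snd (s1 p))" by metis
  obtain K0 where K0: "K0 \<in> \<H>" using ne by blast
  define st where "st b n = rec_nat (K0, topspace X) (\<lambda>n p. if b n then s1 p else s0 p) n" for b :: "nat \<Rightarrow> bool" and n
  have st_0: "st b 0 = (K0, topspace X)" and st_Suc: "st b (Suc n) = (if b n then s1 (st b n) else s0 (st b n))" for b n
    by (simp_all add: st_def)
  have good: "good (st b n)" for b n
  proof (induction n)
    case 0 show ?case using K0 cl[OF K0] closedin_subset by (auto simp: st_0 good_def)
  qed (use s in \<open>auto simp: st_Suc\<close>)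
  define C where "C b n = X closure_of snd (st b n)" for b n
  have C_Suc: "C b (Suc n) \<subseteq> C b n" for b n
    using s[OF good[of b n]] unfolding C_def by (intro closure_of_mono) (auto simp: st_Suc)
  then have C_mono: "m \<le> n \<Longrightarrow> C b n \<subseteq> C b m" for b m n
    using lift_Suc_antimono_le[of "C b"] by blast
  have "\<exists>L. subcontinuum X L \<and> L \<subseteq> \<Inter>(range (C b)) \<and> L \<inter> A \<noteq> {} \<and> L \<inter> B \<noteq> {}" for b
  proof -
    have dir: "\<exists>E\<in>range (C b). E \<subseteq> D \<inter> D'" if "D \<in> range (C b)" "D' \<in> range (C b)" for D D'
    proof -
      obtain m n where "D = C b m" "D' = C b n" using \<open>D \<in> _\<close> \<open>D' \<in> _\<close> by auto
      then have "C b (max m n) \<subseteq> D \<inter> D'" using C_mono[of m "max m n" b] C_mono[of n "max m n" b] by auto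
      then show ?thesis by auto
    qed
    have K: "\<exists>K. connectedin X K \<and> K \<subseteq> D \<and> K \<inter> A \<noteq> {} \<and> K \<inter> B \<noteq> {}" if DC: "D \<in> range (C b)" for D
    proof -
      obtain n where D: "D = C b n" using DC by auto
      have g: "fst (st b n) \<in> \<H>" "openin X (snd (st b n))" "fst (st b n) \<subseteq> snd (st b n)" using good[of b n] by (auto simp: good_def)
      then have "fst (st b n) \<subseteq> D" unfolding D C_def using closure_of_subset openin_subset by (metis order_trans)
      then show ?thesis using sub[OF g(1)] meet[OF g(1)] subcontinuum_iff[OF X(2)] by blast
    qed
    have cl: "closedin X D" if "D \<in> range (C b)" for D using that by (auto simp: C_def)
    show ?thesis
      by (rule directed_Inter_subcontinuum[OF X _ cl dir A B K]) (simp, assumption+, blast)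
  qed
  then obtain L where L: "\<And>b. subcontinuum X (L b) \<and> L b \<subseteq> \<Inter>(range (C b)) \<and> L b \<inter> A \<noteq> {} \<and> L b \<inter> B \<noteq> {}" by metis
  have "nondegenerate (L b)" for b using L[of b] AB unfolding nondegenerate_def by (metis disjoint_iff)
  moreover have "L b \<inter> L c = {}" if "b \<noteq> c" for b c
  proof -
    \<comment> \<open>The first \<open>n\<close> where the branches part; up to it they pass through the same nodes.\<close>
    define n where "n = (LEAST n. b n \<noteq> c n)"
    have "\<exists>n. b n \<noteq> c n" using that by (simp add: fun_eq_iff)
    then have n: "b n \<noteq> c n" unfolding n_def by (rule LeastI_ex[of "\<lambda>n. b n \<noteq> c n"])
    have eq: "b m = c m" if "m < n" for m using not_less_Least[of m "\<lambda>n. b n \<noteq> c n"] that by (auto simp: n_def)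
    have "st b m = st c m" if "m \<le> n" for m
      using that by (induction m) (auto simp: st_0 st_Suc eq)
    then have e: "st b n = st c n" by simp
    have "disjnt (C b (Suc n)) (C c (Suc n))"
    proof (cases "b n")
      case True
      then have "\<not> c n" using n by simp
      then show ?thesis using True s[OF good[of b n]] by (simp add: C_def st_Suc e disjnt_sym)
    next
      case False
      then have "c n" using n by simp
      then show ?thesis using False s[OF good[of b n]] by (simp add: C_def st_Suc e)
    qed
    moreover have "L b \<subseteq> C b (Suc n)" "L c \<subseteq> C c (Suc n)" using L[of b] L[of c] by blast+
    ultimately show ?thesis unfolding disjnt_def by auto
  qed
  ultimately show thesis using that L by metis
qed

text \<open>
  Below \<open>\<cc>\<close> there is no room for the tree: every non-empty disjoint family of continua joining \<open>A\<close> to \<open>B\<close> has a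
  member that is isolated in the upper Vietoris topology.
\<close>

lemma isolated_subcontinuum:
  assumes X: "continuum X" and Sln: "Sln X <o ctwo ^c natLeq"
    and A: "closedin X A" and B: "closedin X B" and AB: "A \<inter> B = {}"
    and ne: "\<H> \<noteq> {}" and dis: "disjoint \<H>" and sub: "\<And>K. K \<in> \<H> \<Longrightarrow> subcontinuum X K"
    and meet: "\<And>K. K \<in> \<H> \<Longrightarrow> K \<inter> A \<noteq> {} \<and> K \<inter> B \<noteq> {}"
  shows "\<exists>K\<in>\<H>. \<exists>U. openin X U \<and> K \<subseteq> U \<and> (\<forall>K'\<in>\<H>. K' \<subseteq> U \<longrightarrow> K' = K)"
proof (rule ccontr)
  assume "\<not> ?thesis"
  then have crowded: "\<exists>K'\<in>\<H>. K' \<noteq> K \<and> K' \<subseteq> U" if "K \<in> \<H>" "openin X U" "K \<subseteq> U" for K U using that by metis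
  have X': "compact_space X" "Hausdorff_space X" using X by (auto simp: continuum_def)
  show False
  proof (rule subcontinua_of_binary_tree[OF X' A B AB ne dis])
    fix L :: "(nat \<Rightarrow> bool) \<Rightarrow> 'a set"
    assume L: "\<And>b. subcontinuum X (L b)" "\<And>b. nondegenerate (L b)" "\<And>b c. b \<noteq> c \<Longrightarrow> L b \<inter> L c = {}"
    have "|UNIV :: (nat \<Rightarrow> bool) set| \<le>o Sln X" by (rule card_of_index_le_Sln[of _ X L]) (simp_all add: L)
    then have "ctwo ^c natLeq \<le>o Sln X"
      by (rule ordIso_ordLeq_trans[OF ordIso_symmetric[OF continuum_eq_card_of_functions]])
    then show False using not_ordLess_ordLeq[OF Sln] by simp
  qed (fact sub, fact meet, fact crowded)
qed

section \<open>The hereditary Lindelof number\<close>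

lemma lindelof_number_members:
  fixes Y :: "'b topology"
  shows "Card_order (lindelof_number Y)"
    and "open_cover Y \<U> \<Longrightarrow> \<exists>\<V>\<subseteq>\<U>. open_cover Y \<V> \<and> |\<V>| \<le>o lindelof_number Y"
proof -
  define R where "R = {\<kappa> :: 'b set rel. Card_order \<kappa> \<and>
       (\<forall>\<U>. open_cover Y \<U> \<longrightarrow> (\<exists>\<V>\<subseteq>\<U>. open_cover Y \<V> \<and> |\<V>| \<le>o \<kappa>))}"
  have "\<exists>\<V>\<subseteq>\<U>. open_cover Y \<V> \<and> |\<V>| \<le>o |UNIV :: 'b set set|" if "open_cover Y \<U>" for \<U>
    using that card_of_mono1[of \<U> UNIV] by auto
  then have "|UNIV :: 'b set set| \<in> R" unfolding R_def by (auto simp: card_of_Card_order)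
  then have "R \<noteq> {}" by auto
  then have "Min_card R \<in> R" by (rule Min_card(1)) (simp add: R_def)
  then have "lindelof_number Y \<in> R" by (simp add: lindelof_number_def R_def)
  then show "Card_order (lindelof_number Y)"
    and "open_cover Y \<U> \<Longrightarrow> \<exists>\<V>\<subseteq>\<U>. open_cover Y \<V> \<and> |\<V>| \<le>o lindelof_number Y"
    by (auto simp: R_def)
qed

text \<open>
  The cardinals among which the Lindelof number is chosen live on the type of sets of points.  This
  form takes bounds on the type of points, as needed for the hyperspace, whose points are sets and
  whose bound is the weight of \<open>X\<close>.
\<close>

lemma lindelof_number_le:
  fixes Y :: "'b topology" and B :: "'b set"
  assumes "\<And>\<U>. open_cover Y \<U> \<Longrightarrow> \<exists>\<V>\<subseteq>\<U>. open_cover Y \<V> \<and> |\<V>| \<le>o |B|"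
  shows "lindelof_number Y \<le>o |B|"
proof -
  \<comment> \<open>Singletons move the bound to the type of sets of points.\<close>
  let ?\<kappa> = "|(\<lambda>b. {b}) ` B|"
  have le: "|B| \<le>o ?\<kappa>" unfolding card_of_ordLeq[symmetric] by (intro exI[of _ "\<lambda>b. {b}"]) (auto simp: inj_on_def)
  have le\<kappa>: "\<exists>\<V>\<subseteq>\<U>. open_cover Y \<V> \<and> |\<V>| \<le>o ?\<kappa>" if "open_cover Y \<U>" for \<U>
    using assms[OF that] ordLeq_transitive[OF _ le] by auto
  define R where "R = {\<kappa> :: 'b set rel. Card_order \<kappa> \<and>
       (\<forall>\<U>. open_cover Y \<U> \<longrightarrow> (\<exists>\<V>\<subseteq>\<U>. open_cover Y \<V> \<and> |\<V>| \<le>o \<kappa>))}"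
  have R: "?\<kappa> \<in> R" using le\<kappa> card_of_Card_order[of "(\<lambda>b. {b}) ` B"] by (simp add: R_def)
  then have "R \<noteq> {}" by auto
  then have "Min_card R \<le>o ?\<kappa>" by (rule Min_card(2)) (use R in \<open>auto simp: R_def\<close>)
  then have "lindelof_number Y \<le>o ?\<kappa>" by (simp add: lindelof_number_def R_def)
  then show ?thesis by (rule ordLeq_transitive[OF _ card_of_image])
qed

lemma Card_order_hereditary_lindelof_number: "Card_order (hereditary_lindelof_number Y)"
  unfolding hereditary_lindelof_number_def by (rule Sup_card) (auto simp: lindelof_number_members)

text \<open>
  The form in which the number is used: a family of open sets of \<open>Y\<close> that covers an arbitrary
  subset \<open>A\<close> can be thinned out.
\<close>

lemma hereditary_lindelof_number_cover:
  assumes A: "A \<subseteq> topspace Y" and op: "\<And>N. N \<in> \<N> \<Longrightarrow> openin Y N" and cov: "A \<subseteq> \<Union>\<N>"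
  obtains \<V> where "\<V> \<subseteq> \<N>" "A \<subseteq> \<Union>\<V>" "|\<V>| \<le>o hereditary_lindelof_number Y"
proof -
  let ?Y = "subtopology Y A"
  have T: "topspace ?Y = A" using A by auto
  have "open_cover ?Y ((\<lambda>N. A \<inter> N) ` \<N>)"
    unfolding open_cover_def T using op cov by (auto intro: openin_subtopology_Int2)
  then obtain \<W> where W: "\<W> \<subseteq> (\<lambda>N. A \<inter> N) ` \<N>" "open_cover ?Y \<W>" "|\<W>| \<le>o lindelof_number ?Y"
    using lindelof_number_members(2) by metis
  obtain \<V> where V: "\<V> \<subseteq> \<N>" "inj_on (\<lambda>N. A \<inter> N) \<V>" "\<W> = (\<lambda>N. A \<inter> N) ` \<V>"
    using W(1) unfolding subset_image_inj by metis
  have "|\<V>| \<le>o |\<W>|" unfolding card_of_ordLeq[symmetric] using V by auto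
  also have "|\<W>| \<le>o lindelof_number ?Y" by (rule W(3))
  also have "lindelof_number ?Y \<le>o hereditary_lindelof_number Y"
    unfolding hereditary_lindelof_number_def using A by (intro Sup_card(2)) (auto simp: lindelof_number_members)
  finally have "|\<V>| \<le>o hereditary_lindelof_number Y" .
  moreover have "A \<subseteq> \<Union>\<V>" using W(2) V(3) unfolding open_cover_def T by auto
  ultimately show thesis using that V(1) by metis
qed

text \<open>
  For a network \<open>\<M>\<close> it suffices to pick one member of the cover for each set of \<open>\<M>\<close> that fits into one.
  The sets of a network need not be open, and its traces are networks of the subspaces.
\<close>

lemma hereditary_lindelof_number_le_network:
  fixes Y :: "'b topology" and B :: "'b set"
  assumes c: "|\<M>| \<le>o |B|"
    and net: "\<And>W y. openin Y W \<Longrightarrow> y \<in> W \<Longrightarrow> \<exists>M\<in>\<M>. y \<in> M \<and> topspace Y \<inter> M \<subseteq> W"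
  shows "hereditary_lindelof_number Y \<le>o |B|"
proof -
  have "lindelof_number (subtopology Y A) \<le>o |B|" if A: "A \<subseteq> topspace Y" for A
  proof (rule lindelof_number_le)
    fix \<U> assume U: "open_cover (subtopology Y A) \<U>"
    have T: "\<Union>\<U> = A" using U A by (auto simp: open_cover_def)
    define \<M>' where "\<M>' = {M \<in> \<M>. \<exists>U\<in>\<U>. A \<inter> M \<subseteq> U}"
    define u where "u M = (SOME U. U \<in> \<U> \<and> A \<inter> M \<subseteq> U)" for M
    have u: "u M \<in> \<U> \<and> A \<inter> M \<subseteq> u M" if "M \<in> \<M>'" for M
      unfolding u_def by (rule someI_ex) (use that in \<open>auto simp: \<M>'_def\<close>)
    have sub: "u ` \<M>' \<subseteq> \<U>" using u by auto
    have "A \<subseteq> \<Union>(u ` \<M>')"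
    proof
      fix y assume y: "y \<in> A"
      then obtain U where UU: "U \<in> \<U>" "y \<in> U" using T by auto
      then have "openin (subtopology Y A) U" using U by (auto simp: open_cover_def)
      then obtain W where W: "openin Y W" "U = W \<inter> A" by (auto simp: openin_subtopology)
      then obtain M where M: "M \<in> \<M>" "y \<in> M" "topspace Y \<inter> M \<subseteq> W" using net[of W y] UU by auto
      have "A \<inter> M \<subseteq> U" using M W A by auto
      then have "M \<in> \<M>'" using M UU by (auto simp: \<M>'_def)
      then show "y \<in> \<Union>(u ` \<M>')" using u[of M] y M by auto
    qed
    moreover have "\<Union>(u ` \<M>') \<subseteq> A" using sub T by auto
    ultimately have "\<Union>(u ` \<M>') = topspace (subtopology Y A)" using A by auto
    then have "open_cover (subtopology Y A) (u ` \<M>')" using U sub by (auto simp: open_cover_def)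
    moreover have "|u ` \<M>'| \<le>o |B|"
      by (intro card_of_image_bound card_of_subset_bound[OF c]) (auto simp: \<M>'_def)
    ultimately show "\<exists>\<V>\<subseteq>\<U>. open_cover (subtopology Y A) \<V> \<and> |\<V>| \<le>o |B|" using sub by auto
  qed
  then show ?thesis
    unfolding hereditary_lindelof_number_def
    by (intro Sup_card(3)) (auto simp: lindelof_number_members card_of_Card_order)
qed

section \<open>The hyperspace of subcontinua\<close>

lemma topspace_expc_space:
  assumes "continuum X"
  shows "topspace (expc_space X) = {K. subcontinuum X K \<and> K \<noteq> {}}"
  using subcontinuum_closedin[OF assms]
  by (auto simp: expc_space_def topspace_exp_space exp_carrier_def)

lemma openin_expc_space:
  assumes X: "continuum X" and U: "openin X U"
  shows "openin (expc_space X) {K \<in> topspace (expc_space X). K \<subseteq> U}"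
    and "openin (expc_space X) {K \<in> topspace (expc_space X). K \<inter> U \<noteq> {}}"
proof -
  have T: "topspace (expc_space X) = exp_carrier X \<inter> {K. subcontinuum X K}"
    by (simp add: expc_space_def topspace_exp_space)
  have "openin (exp_space X) {F \<in> exp_carrier X. F \<subseteq> U}"
    unfolding exp_space_def by (rule topology_generated_by_Basis) (use U in auto)
  then have "openin (expc_space X) ({F \<in> exp_carrier X. F \<subseteq> U} \<inter> {K. subcontinuum X K})"
    unfolding expc_space_def by (rule openin_subtopology_Int)
  moreover have "{F \<in> exp_carrier X. F \<subseteq> U} \<inter> {K. subcontinuum X K} = {K \<in> topspace (expc_space X). K \<subseteq> U}"
    by (auto simp: T)
  ultimately show "openin (expc_space X) {K \<in> topspace (expc_space X). K \<subseteq> U}" by simp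
  have "openin (exp_space X) {F \<in> exp_carrier X. F \<inter> U \<noteq> {}}"
    unfolding exp_space_def by (rule topology_generated_by_Basis) (use U in auto)
  then have "openin (expc_space X) ({F \<in> exp_carrier X. F \<inter> U \<noteq> {}} \<inter> {K. subcontinuum X K})"
    unfolding expc_space_def by (rule openin_subtopology_Int)
  moreover have "{F \<in> exp_carrier X. F \<inter> U \<noteq> {}} \<inter> {K. subcontinuum X K} = {K \<in> topspace (expc_space X). K \<inter> U \<noteq> {}}"
    by (auto simp: T)
  ultimately show "openin (expc_space X) {K \<in> topspace (expc_space X). K \<inter> U \<noteq> {}}" by simp
qed

text \<open>
  Continua taken from disjoint open sets form an infinite discrete subspace of the hyperspace.
\<close>

lemma Cinfinite_hereditary_lindelof_expc:
  assumes X: "continuum X" "nondegenerate (topspace X)"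
  shows "Cinfinite (hereditary_lindelof_number (expc_space X))"
proof -
  let ?E = "expc_space X"
  obtain U :: "nat \<Rightarrow> 'a set" where U: "\<And>n. openin X (U n)" "\<And>n. U n \<noteq> {}" "\<And>m n. m \<noteq> n \<Longrightarrow> U m \<inter> U n = {}"
    using infinitely_many_disjoint_open[OF X] by metis
  have "\<exists>K. subcontinuum X K \<and> nondegenerate K \<and> K \<subseteq> U n" for n
    using subcontinuum_in_open[OF X U(1,2)] by metis
  then obtain K where K: "\<And>n. subcontinuum X (K n) \<and> nondegenerate (K n) \<and> K n \<subseteq> U n" by metis
  define N where "N n = {F \<in> topspace ?E. F \<subseteq> U n}" for n
  have KE: "K n \<in> topspace ?E" and Kne: "K n \<noteq> {}" for n
    using K[of n] by (auto simp: topspace_expc_space[OF X(1)] nondegenerate_def)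
  have unique: "m = n" if "K m \<in> N n" for m n
  proof (rule ccontr)
    assume "m \<noteq> n"
    then show False using U(3)[of m n] K[of m] Kne[of m] that by (auto simp: N_def)
  qed
  obtain \<V> where V: "\<V> \<subseteq> range N" "range K \<subseteq> \<Union>\<V>" "|\<V>| \<le>o hereditary_lindelof_number ?E"
  proof (rule hereditary_lindelof_number_cover)
    show "range K \<subseteq> topspace ?E" using KE by auto
    show "openin ?E M" if "M \<in> range N" for M using that openin_expc_space(1)[OF X(1) U(1)] by (auto simp: N_def)
    show "range K \<subseteq> \<Union>(range N)" using K KE by (auto simp: N_def)
  qed
  have inV: "N n \<in> \<V>" for n
  proof -
    obtain M where M: "M \<in> \<V>" "K n \<in> M" using V(2) by auto
    then obtain m where "M = N m" using V(1) by auto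
    then show ?thesis using unique[of n m] M by auto
  qed
  have "inj N"
  proof (rule injI)
    fix m n assume "N m = N n"
    moreover have "K m \<in> N m" using K KE by (auto simp: N_def)
    ultimately show "m = n" using unique by simp
  qed
  then have "|UNIV::nat set| \<le>o |\<V>|" unfolding card_of_ordLeq[symmetric] using inV by auto
  then have "natLeq \<le>o hereditary_lindelof_number ?E"
    by (meson V(3) card_of_nat ordIso_symmetric ordIso_ordLeq_trans ordLeq_transitive)
  then show ?thesis using Card_order_hereditary_lindelof_number cinfinite_mono natLeq_cinfinite by auto
qed

text \<open>
  Let \<open>\<kappa>\<close> be the hereditary Lindelof number.  The members of \<open>\<C>\<close> with a neighbourhood that contains
  at most \<open>\<kappa>\<close> members are covered by \<open>\<kappa>\<close> such neighbourhoods, so there are at most \<open>\<kappa>\<close> of them.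
  Among the others no member is isolated, which leaves none by \<open>isolated_subcontinuum\<close>.
\<close>

theorem Sln_le_hereditary_lindelof_expc:
  assumes X: "continuum X" "nondegenerate (topspace X)" and Sln: "Sln X <o ctwo ^c natLeq"
  shows "Sln X \<le>o hereditary_lindelof_number (expc_space X)"
proof (rule Sln_least)
  let ?E = "expc_space X" let ?\<kappa> = "hereditary_lindelof_number (expc_space X)"
  show card: "Card_order ?\<kappa>" by (rule Card_order_hereditary_lindelof_number)
  have inf: "Cinfinite ?\<kappa>" by (rule Cinfinite_hereditary_lindelof_expc[OF X])
  fix \<C> assume "\<forall>K\<in>\<C>. subcontinuum X K \<and> nondegenerate K" and dis: "disjoint \<C>"
  then have sub: "subcontinuum X K" and nd: "nondegenerate K" if "K \<in> \<C>" for K using that by auto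
  then have CE: "\<C> \<subseteq> topspace ?E" by (auto simp: topspace_expc_space[OF X(1)] nondegenerate_def)
  define \<N> where "\<N> = {N. openin ?E N \<and> |N \<inter> \<C>| \<le>o ?\<kappa>}"
  define \<L> where "\<L> = \<C> \<inter> \<Union>\<N>"
  obtain \<V> where V: "\<V> \<subseteq> \<N>" "\<L> \<subseteq> \<Union>\<V>" "|\<V>| \<le>o ?\<kappa>"
    by (rule hereditary_lindelof_number_cover[of \<L> ?E \<N>]) (use CE in \<open>auto simp: \<L>_def \<N>_def\<close>)
  have "|\<Union>N\<in>\<V>. N \<inter> \<C>| \<le>o ?\<kappa>"
    by (intro UNION_Cinfinite_bound V inf) (use V(1) in \<open>auto simp: \<N>_def\<close>)
  then have L: "|\<L>| \<le>o ?\<kappa>" by (rule card_of_subset_bound) (use V(2) in \<open>auto simp: \<L>_def\<close>)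
  have "\<C> \<subseteq> \<L>"
  proof (rule ccontr)
    assume "\<not> \<C> \<subseteq> \<L>"
    then obtain K0 where K0: "K0 \<in> \<C>" "K0 \<notin> \<L>" by auto
    obtain x y where xy: "x \<in> K0" "y \<in> K0" "x \<noteq> y" using nd[OF K0(1)] by (auto simp: nondegenerate_def)
    have "x \<in> topspace X" "y \<in> topspace X" using xy sub[OF K0(1)] by (auto simp: subcontinuum_def)
    then have cl: "closedin X {x}" "closedin X {y}" using X by (auto simp: continuum_def closedin_Hausdorff_sing_eq)
    have "disjnt {x} {y}" using xy by auto
    then obtain U V where UV: "openin X U" "openin X V" "{x} \<subseteq> U" "{y} \<subseteq> V" "disjnt (X closure_of U) (X closure_of V)"
      using continuum_normal[OF X(1)] cl unfolding normal_space_disjoint_closures by metis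
    \<comment> \<open>Members near \<open>K0\<close> join the closures of \<open>U\<close> and \<open>V\<close>.\<close>
    define \<H> where "\<H> = {K \<in> \<C> - \<L>. K \<inter> U \<noteq> {} \<and> K \<inter> V \<noteq> {}}"
    have "\<exists>K\<in>\<H>. \<exists>W. openin X W \<and> K \<subseteq> W \<and> (\<forall>K'\<in>\<H>. K' \<subseteq> W \<longrightarrow> K' = K)"
    proof (rule isolated_subcontinuum[OF X(1) Sln])
      show "closedin X (X closure_of U)" "closedin X (X closure_of V)" by auto
      show "X closure_of U \<inter> X closure_of V = {}" using UV(5) by (simp add: disjnt_def)
      show "\<H> \<noteq> {}" using K0 xy UV by (auto simp: \<H>_def)
      show "disjoint \<H>" using dis by (rule pairwise_subset) (auto simp: \<H>_def)
      show "subcontinuum X K" if "K \<in> \<H>" for K using that sub by (auto simp: \<H>_def)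
      show "K \<inter> X closure_of U \<noteq> {} \<and> K \<inter> X closure_of V \<noteq> {}" if "K \<in> \<H>" for K
        using that closure_of_subset[OF openin_subset[OF UV(1)]] closure_of_subset[OF openin_subset[OF UV(2)]]
        by (auto simp: \<H>_def)
    qed
    then obtain K W where KW: "K \<in> \<H>" "openin X W" "K \<subseteq> W" "\<And>K'. K' \<in> \<H> \<Longrightarrow> K' \<subseteq> W \<Longrightarrow> K' = K" by metis
    define N where "N = {F \<in> topspace ?E. F \<subseteq> W} \<inter> {F \<in> topspace ?E. F \<inter> U \<noteq> {}} \<inter> {F \<in> topspace ?E. F \<inter> V \<noteq> {}}"
    have "openin ?E N" unfolding N_def by (intro openin_Int openin_expc_space X UV KW)
    moreover have "|N \<inter> \<C>| \<le>o ?\<kappa>"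
    proof (rule card_of_subset_bound)
      show "|\<L> \<union> {K}| \<le>o ?\<kappa>" by (intro Un_Cinfinite_bound L inf card_of_countable_bound) auto
      show "N \<inter> \<C> \<subseteq> \<L> \<union> {K}" using KW(4) by (auto simp: N_def \<H>_def)
    qed
    moreover have "K \<in> N" "K \<in> \<C>" "K \<notin> \<L>" using KW(1,3) CE by (auto simp: N_def \<H>_def)
    ultimately show False by (auto simp: \<L>_def \<N>_def)
  qed
  then show "|\<C>| \<le>o ?\<kappa>" by (rule card_of_subset_bound[OF L])
qed

text \<open>
  Approximating the subbasic sets at every point of \<open>T\<close> is enough, because the finite intersections of
  the approximating sets then follow the generation of an open set.
\<close>

lemma finite_intersection_network:
  assumes sub: "\<And>s x. s \<in> \<S> \<Longrightarrow> x \<in> s \<Longrightarrow> x \<in> T \<Longrightarrow> \<exists>M\<in>\<M>. x \<in> M \<and> T \<inter> M \<subseteq> s"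
    and W: "openin (topology_generated_by \<S>) W" "x \<in> W" "x \<in> T"
  shows "\<exists>\<Q>\<in>Fpow \<M>. x \<in> \<Inter>\<Q> \<and> T \<inter> \<Inter>\<Q> \<subseteq> W"
proof -
  have "generate_topology_on \<S> W" using W(1) by (simp add: openin_topology_generated_by_iff)
  then show ?thesis using W(2)
  proof (induction W)
    case (Int a b)
    then obtain \<P> \<Q> where "\<P> \<in> Fpow \<M>" "x \<in> \<Inter>\<P>" "T \<inter> \<Inter>\<P> \<subseteq> a" "\<Q> \<in> Fpow \<M>" "x \<in> \<Inter>\<Q>" "T \<inter> \<Inter>\<Q> \<subseteq> b"
      by (metis IntD1 IntD2)
    then show ?case by (intro bexI[of _ "\<P> \<union> \<Q>"]) (auto simp: Fpow_def)
  next
    case (UN K)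
    then obtain k where k: "k \<in> K" "x \<in> k" by auto
    then obtain \<Q> where "\<Q> \<in> Fpow \<M>" "x \<in> \<Inter>\<Q>" "T \<inter> \<Inter>\<Q> \<subseteq> k" using UN.IH[OF k] by metis
    then show ?case using k(1) by (intro bexI[of _ \<Q>]) auto
  next
    case (Basis s)
    then obtain M where "M \<in> \<M>" "x \<in> M" "T \<inter> M \<subseteq> s" using sub[of s x] W(3) by auto
    then show ?case by (intro bexI[of _ "{M}"]) (auto simp: Fpow_def)
  qed simp
qed

text \<open>
  A continuum in an open set is compact and therefore lies in the union of finitely many basic sets inside that
  open set.  So the two kinds of subbasic Vietoris sets can be approximated by sets coming from finite subsets
  of a base.
\<close>

theorem hereditary_lindelof_expc_le_weight:
  assumes X: "continuum X" "nondegenerate (topspace X)"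
  shows "hereditary_lindelof_number (expc_space X) \<le>o weight X"
proof -
  let ?E = "expc_space X" let ?T = "topspace (expc_space X)"
  obtain \<B> where B: "base_of X \<B>" "weight X = |\<B>|" by (rule weight_base)
  have inf: "Cinfinite |\<B>|" using Cinfinite_weight[OF X] B(2) by simp
  have refl: "|\<B>| \<le>o |\<B>|" by (rule card_of_refl[THEN ordIso_imp_ordLeq])
  define \<M> where "\<M> = (\<lambda>\<S>. {K \<in> ?T. K \<subseteq> \<Union>\<S>}) ` Fpow \<B> \<union> (\<lambda>b. {K \<in> ?T. K \<inter> b \<noteq> {}}) ` \<B>"
  have M: "|\<M>| \<le>o |\<B>|"
    unfolding \<M>_def by (intro Un_Cinfinite_bound card_of_image_bound card_of_Fpow_bound inf refl)
  define \<S> where "\<S> = {{F \<in> exp_carrier X. F \<subseteq> U} | U. openin X U} \<union>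
      {{F \<in> exp_carrier X. F \<inter> U \<noteq> {}} | U. openin X U}"
  have TC: "K \<in> ?T \<Longrightarrow> K \<in> exp_carrier X" for K by (auto simp: expc_space_def topspace_exp_space)
  have sub: "\<exists>M\<in>\<M>. K \<in> M \<and> ?T \<inter> M \<subseteq> s" if s: "s \<in> \<S>" "K \<in> s" and K: "K \<in> ?T" for s K
  proof -
    have "compactin X K" using K X by (auto simp: topspace_expc_space continuum_def subcontinuum_iff)
    consider U where "openin X U" "s = {F \<in> exp_carrier X. F \<subseteq> U}"
      | U where "openin X U" "s = {F \<in> exp_carrier X. F \<inter> U \<noteq> {}}" using s(1) by (auto simp: \<S>_def)
    then show ?thesis
    proof cases
      case 1
      have "K \<subseteq> \<Union>{b \<in> \<B>. b \<subseteq> U}"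
      proof
        fix x assume "x \<in> K"
        then have "x \<in> U" using s(2) 1(2) by auto
        then obtain b where "b \<in> \<B>" "x \<in> b" "b \<subseteq> U" using B(1) 1(1) unfolding base_of_iff by metis
        then show "x \<in> \<Union>{b \<in> \<B>. b \<subseteq> U}" by auto
      qed
      then have "\<exists>\<F>. finite \<F> \<and> \<F> \<subseteq> {b \<in> \<B>. b \<subseteq> U} \<and> K \<subseteq> \<Union>\<F>"
        using B(1) by (intro compactinD[OF \<open>compactin X K\<close>]) (auto simp: base_of_iff)
      then obtain \<F> where F: "finite \<F>" "\<F> \<subseteq> {b \<in> \<B>. b \<subseteq> U}" "K \<subseteq> \<Union>\<F>" by metis
      have "\<F> \<in> Fpow \<B>" using F by (auto simp: Fpow_def)
      then have "{K \<in> ?T. K \<subseteq> \<Union>\<F>} \<in> \<M>" unfolding \<M>_def by (intro UnI1 imageI)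
      moreover have "K \<in> {K \<in> ?T. K \<subseteq> \<Union>\<F>}" using F K by simp
      moreover have "?T \<inter> {K \<in> ?T. K \<subseteq> \<Union>\<F>} \<subseteq> s"
      proof
        fix L assume L: "L \<in> ?T \<inter> {K \<in> ?T. K \<subseteq> \<Union>\<F>}"
        have "\<Union>\<F> \<subseteq> U" using F(2) by auto
        then have "L \<subseteq> U" using L by auto
        then show "L \<in> s" using L TC[of L] unfolding 1(2) by simp
      qed
      ultimately show ?thesis by metis
    next
      case 2
      then obtain x where x: "x \<in> K" "x \<in> U" using s(2) by auto
      then obtain b where b: "b \<in> \<B>" "x \<in> b" "b \<subseteq> U" using B(1) 2(1) unfolding base_of_iff by metis
      then have "{K \<in> ?T. K \<inter> b \<noteq> {}} \<in> \<M>" unfolding \<M>_def by (intro UnI2 imageI)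
      moreover have "K \<in> {K \<in> ?T. K \<inter> b \<noteq> {}}" using x b K by auto
      moreover have "?T \<inter> {K \<in> ?T. K \<inter> b \<noteq> {}} \<subseteq> s" using b TC unfolding 2(2) by auto
      ultimately show ?thesis by metis
    qed
  qed
  show ?thesis
    unfolding B(2)
  proof (rule hereditary_lindelof_number_le_network)
    show "|Inter ` Fpow \<M>| \<le>o |\<B>|" by (intro card_of_image_bound card_of_Fpow_bound inf M)
    fix W K assume W: "openin ?E W" "K \<in> W"
    then obtain W' where W': "openin (exp_space X) W'" "W = W' \<inter> {K. subcontinuum X K}"
      by (auto simp: expc_space_def openin_subtopology)
    have "K \<in> ?T" using W openin_subset by auto
    then have "\<exists>\<Q>\<in>Fpow \<M>. K \<in> \<Inter>\<Q> \<and> ?T \<inter> \<Inter>\<Q> \<subseteq> W'"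
      using W W' by (intro finite_intersection_network[OF sub, of \<S>]) (auto simp: exp_space_def \<S>_def)
    then show "\<exists>M\<in>Inter ` Fpow \<M>. K \<in> M \<and> ?T \<inter> M \<subseteq> W"
      using W'(2) by (auto simp: expc_space_def)
  qed
qed

section \<open>Weight and light families of functions\<close>

text \<open>
  Let \<open>\<D>\<close> consist of the non-degenerate components of the boxes \<open>a \<le> \<phi> \<le> b\<close> given by finitely
  many \<open>\<phi>\<close> in \<open>\<Phi>\<close> and rational \<open>a\<close>, \<open>b\<close>.  A point in the open box lies in a member of \<open>\<D>\<close> by boundary
  bumping.  Points with different values under some \<open>\<phi>\<close> lie in disjoint boxes.  Points \<open>x\<close> and \<open>y\<close> in
  one fibre have different components in some box around them: otherwise the
  intersection of all boxes around \<open>x\<close>, which is the fibre, would contain a continuum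
  joining \<open>x\<close> to \<open>y\<close>.
\<close>

lemma weight_le_of_light:
  fixes \<Phi> :: "('a \<Rightarrow> real) set"
  assumes X: "continuum X" "nondegenerate (topspace X)" and c: "Cinfinite c" and Sln: "Sln X \<le>o c"
    and cont: "\<And>\<phi>. \<phi> \<in> \<Phi> \<Longrightarrow> continuous_map X euclideanreal \<phi>" and \<Phi>: "|\<Phi>| \<le>o c" and S: "closedin X S"
    and light: "\<And>K x. subcontinuum X K \<Longrightarrow> nondegenerate K \<Longrightarrow> x \<in> S \<Longrightarrow> x \<in> K \<Longrightarrow> \<exists>\<phi>\<in>\<Phi>. \<exists>z\<in>K. \<phi> z \<noteq> \<phi> x"
  shows "weight (subtopology X S) \<le>o c"
proof -
  have X': "compact_space X" "Hausdorff_space X" using X by (auto simp: continuum_def)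
  have SX: "S \<subseteq> topspace X" using S closedin_subset by auto
  define I where "I = Fpow (\<Phi> \<times> (\<rat> :: real set) \<times> (\<rat> :: real set))"
  define box where "box T = {x \<in> topspace X. \<forall>(\<phi>,a,b)\<in>T. a \<le> \<phi> x \<and> \<phi> x \<le> b}" for T :: "(('a \<Rightarrow> real) \<times> real \<times> real) set"
  define obox where "obox T = {x \<in> topspace X. \<forall>(\<phi>,a,b)\<in>T. a < \<phi> x \<and> \<phi> x < b}" for T :: "(('a \<Rightarrow> real) \<times> real \<times> real) set"
  define comp where "comp T x = connected_component_of_set (subtopology X (box T)) x" for T x
  define \<D> where "\<D> = (\<Union>T\<in>I. {K \<in> connected_components_of (subtopology X (box T)). nondegenerate K})"
  have "|I| \<le>o c"
    unfolding I_def by (intro card_of_Fpow_bound card_of_Times_bound card_of_countable_bound \<Phi> c countable_rat)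
  have closed_strip: "closedin X {x \<in> topspace X. a \<le> \<phi> x \<and> \<phi> x \<le> b}" if "\<phi> \<in> \<Phi>" for \<phi> a b
    using closedin_continuous_map_preimage[OF cont[OF that], of "{a..b}"] by simp
  have open_strip: "openin X {x \<in> topspace X. a < \<phi> x \<and> \<phi> x < b}" if "\<phi> \<in> \<Phi>" for \<phi> a b
    using openin_continuous_map_preimage[OF cont[OF that], of "{a<..<b}"] by simp
  have closed: "closedin X (box T)" if T: "T \<in> I" for T
  proof -
    have "closedin X (\<Inter>(insert (topspace X) ((\<lambda>(\<phi>,a,b). {x \<in> topspace X. a \<le> \<phi> x \<and> \<phi> x \<le> b}) ` T)))"
    proof (rule closedin_Inter)
      fix C assume "C \<in> insert (topspace X) ((\<lambda>(\<phi>,a,b). {x \<in> topspace X. a \<le> \<phi> x \<and> \<phi> x \<le> b}) ` T)"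
      then consider "C = topspace X" | \<phi> a b where "\<phi> \<in> \<Phi>" "C = {x \<in> topspace X. a \<le> \<phi> x \<and> \<phi> x \<le> b}"
        using T by (auto simp: I_def Fpow_def)
      then show "closedin X C"
        by cases (simp_all add: closed_strip)
    qed simp
    moreover have "\<Inter>(insert (topspace X) ((\<lambda>(\<phi>,a,b). {x \<in> topspace X. a \<le> \<phi> x \<and> \<phi> x \<le> b}) ` T)) = box T"
      by (auto simp: box_def)
    ultimately show ?thesis by simp
  qed
  have "openin X (obox T)" if T: "T \<in> I" for T
  proof -
    have "openin X (topspace X \<inter> \<Inter>((\<lambda>(\<phi>,a,b). {x \<in> topspace X. a < \<phi> x \<and> \<phi> x < b}) ` T))"
    proof (rule openin_Int_Inter)
      fix C assume "C \<in> (\<lambda>(\<phi>,a,b). {x \<in> topspace X. a < \<phi> x \<and> \<phi> x < b}) ` T"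
      then obtain \<phi> a b where "\<phi> \<in> \<Phi>" "C = {x \<in> topspace X. a < \<phi> x \<and> \<phi> x < b}"
        using T by (auto simp: I_def Fpow_def)
      then show "openin X C" by (simp add: open_strip)
    qed (use T in \<open>auto simp: I_def Fpow_def\<close>)
    moreover have "topspace X \<inter> \<Inter>((\<lambda>(\<phi>,a,b). {x \<in> topspace X. a < \<phi> x \<and> \<phi> x < b}) ` T) = obox T"
      by (auto simp: obox_def)
    ultimately show ?thesis by simp
  qed
  moreover have "obox T \<subseteq> box T" for T by (force simp: box_def obox_def)
  ultimately have int: "x \<in> X interior_of box T" if "T \<in> I" "x \<in> obox T" for T x
    using that interior_of_maximal by blast
  have comp: "subcontinuum X (comp T x)" "nondegenerate (comp T x)" "x \<in> comp T x" "comp T x \<subseteq> box T" "comp T x \<in> \<D>"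
    if T: "T \<in> I" and x: "x \<in> obox T" for T x
  proof -
    have xb: "x \<in> box T" using int[OF T x] interior_of_subset by fastforce
    show "subcontinuum X (comp T x)" "x \<in> comp T x" "comp T x \<subseteq> box T"
      unfolding comp_def using subcontinuum_component[OF X' closed[OF T] xb] by auto
    show nd: "nondegenerate (comp T x)"
      unfolding comp_def by (rule nondegenerate_component[OF X closed[OF T] int[OF T x]])
    have "comp T x \<in> connected_components_of (subtopology X (box T))"
      unfolding comp_def using xb by (auto simp: connected_component_in_connected_components_of box_def)
    then show "comp T x \<in> \<D>" using nd T by (auto simp: \<D>_def)
  qed
  have sub\<D>: "subcontinuum X K" if TK: "T \<in> I" "K \<in> connected_components_of (subtopology X (box T))" for T K
  proof -
    obtain x where "x \<in> topspace (subtopology X (box T))" "K = connected_component_of_set (subtopology X (box T)) x"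
      using TK(2) by (auto simp: connected_components_of_def)
    then show ?thesis using subcontinuum_component(1)[OF X' closed[OF TK(1)]] by auto
  qed
  have "|\<D>| \<le>o c"
    unfolding \<D>_def
  proof (intro UNION_Cinfinite_bound c ballI)
    fix T assume "T \<in> I"
    have "|{K \<in> connected_components_of (subtopology X (box T)). nondegenerate K}| \<le>o Sln X"
    proof (rule card_of_le_Sln)
      show "disjoint {K \<in> connected_components_of (subtopology X (box T)). nondegenerate K}"
        by (rule pairwise_subset[OF pairwise_disjoint_connected_components_of]) auto
    qed (use sub\<D> \<open>T \<in> I\<close> in auto)
    then show "|{K \<in> connected_components_of (subtopology X (box T)). nondegenerate K}| \<le>o c"
      using Sln by (rule ordLeq_transitive)
  qed fact
  have sep_values: "\<exists>D\<in>\<D>. \<exists>E\<in>\<D>. x \<in> D \<and> y \<in> E \<and> D \<inter> E = {}"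
    if xy: "x \<in> S" "y \<in> S" and \<phi>: "\<phi> \<in> \<Phi>" "\<phi> x < \<phi> y" for x y \<phi>
  proof -
    obtain q where q: "q \<in> \<rat>" "\<phi> x < q" "q < \<phi> y" using Rats_dense_in_real[OF \<phi>(2)] by auto
    obtain q' where q': "q' \<in> \<rat>" "q < q'" "q' < \<phi> y" using Rats_dense_in_real[OF q(3)] by auto
    obtain a where a: "a \<in> \<rat>" "a < \<phi> x" using Rats_no_bot_less by auto
    obtain b where b: "b \<in> \<rat>" "\<phi> y < b" using Rats_no_top_le[of "\<phi> y + 1"] by force
    let ?T = "{(\<phi>,a,q)}" let ?T' = "{(\<phi>,q',b)}"
    have T: "?T \<in> I" "?T' \<in> I" "x \<in> obox ?T" "y \<in> obox ?T'"
      using a b q q' \<phi> xy SX by (auto simp: I_def Fpow_def obox_def)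
    have "box ?T \<inter> box ?T' = {}" using q' by (auto simp: box_def)
    then have "comp ?T x \<inter> comp ?T' y = {}" using comp(4)[OF T(1,3)] comp(4)[OF T(2,4)] by auto
    then show ?thesis using comp(3,5)[OF T(1,3)] comp(3,5)[OF T(2,4)] by auto
  qed
  show ?thesis
  proof (rule weight_closed_subset_le[OF X' S])
    show "closedin X D" if "D \<in> \<D>" for D
      using that sub\<D> subcontinuum_closedin[OF X(1)] by (auto simp: \<D>_def)
    fix x y assume x: "x \<in> S" and y: "y \<in> S" and "x \<noteq> y"
    show "\<exists>D\<in>\<D>. \<exists>E\<in>\<D>. x \<in> D \<and> y \<in> E \<and> D \<inter> E = {}"
    proof (cases "\<exists>\<phi>\<in>\<Phi>. \<phi> x \<noteq> \<phi> y")
      case True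
      then obtain \<phi> where "\<phi> \<in> \<Phi>" "\<phi> x < \<phi> y \<or> \<phi> y < \<phi> x" by force
      then show ?thesis using sep_values[OF x y, of \<phi>] sep_values[OF y x, of \<phi>] by (metis Int_commute)
    next
      case False
      define Ix where "Ix = {T \<in> I. x \<in> obox T}"
      have yT: "y \<in> obox T" if "T \<in> Ix" for T
      proof -
        have "a < \<phi> y \<and> \<phi> y < b" if "(\<phi>,a,b) \<in> T" for \<phi> a b
        proof -
          have "T \<subseteq> \<Phi> \<times> \<rat> \<times> \<rat>" using \<open>T \<in> Ix\<close> by (auto simp: Ix_def I_def Fpow_def)
          then have "\<phi> \<in> \<Phi>" using that by auto
          then have "\<phi> x = \<phi> y" using False by auto
          moreover have "a < \<phi> x \<and> \<phi> x < b" using \<open>T \<in> Ix\<close> that by (auto simp: Ix_def obox_def)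
          ultimately show ?thesis by simp
        qed
        then show ?thesis using y SX by (auto simp: obox_def)
      qed
      have "\<exists>T\<in>Ix. y \<notin> comp T x"
      proof (rule ccontr)
        assume "\<not> ?thesis"
        then have all: "y \<in> comp T x" if "T \<in> Ix" for T using that by auto
        have clx: "closedin X {x}" "closedin X {y}"
          using X' x y SX by (auto simp: closedin_Hausdorff_sing_eq)
        show False
        proof (rule directed_Inter_subcontinuum[OF X' _ _ _ clx, of "box ` Ix"])
          have "{} \<in> Ix" using x SX by (auto simp: Ix_def I_def Fpow_def obox_def)
          then show "box ` Ix \<noteq> {}" by auto
          show "closedin X C" if "C \<in> box ` Ix" for C using that closed by (auto simp: Ix_def)
          show "\<exists>E\<in>box ` Ix. E \<subseteq> C \<inter> D" if "C \<in> box ` Ix" "D \<in> box ` Ix" for C D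
          proof -
            obtain T T' where "T \<in> Ix" "C = box T" "T' \<in> Ix" "D = box T'" using \<open>C \<in> _\<close> \<open>D \<in> _\<close> by auto
            moreover have "T \<union> T' \<in> Ix" using \<open>T \<in> Ix\<close> \<open>T' \<in> Ix\<close> by (auto simp: Ix_def I_def Fpow_def obox_def)
            moreover have "box (T \<union> T') = box T \<inter> box T'" unfolding box_def ball_Un by blast
            ultimately show ?thesis by (intro bexI[of _ "box (T \<union> T')"]) auto
          qed
          show "\<exists>K. connectedin X K \<and> K \<subseteq> C \<and> K \<inter> {x} \<noteq> {} \<and> K \<inter> {y} \<noteq> {}" if C: "C \<in> box ` Ix" for C
          proof -
            obtain T where T: "T \<in> I" "x \<in> obox T" "C = box T" "T \<in> Ix" using C by (auto simp: Ix_def)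
            then show ?thesis
              using comp[OF T(1,2)] all[OF T(4)] subcontinuum_iff[OF X'(2)] by (intro exI[of _ "comp T x"]) auto
          qed
          fix K assume K: "subcontinuum X K" "K \<subseteq> \<Inter>(box ` Ix)" "K \<inter> {x} \<noteq> {}" "K \<inter> {y} \<noteq> {}"
          then have "nondegenerate K" using \<open>x \<noteq> y\<close> by (auto simp: nondegenerate_def)
          then obtain \<phi> z where z: "\<phi> \<in> \<Phi>" "z \<in> K" "\<phi> z \<noteq> \<phi> x" using light[OF K(1) _ x] K by auto
          have "\<exists>a b. a \<in> \<rat> \<and> b \<in> \<rat> \<and> a < \<phi> x \<and> \<phi> x < b \<and> (\<phi> z < a \<or> b < \<phi> z)"
          proof (cases "\<phi> z < \<phi> x")
            case True
            obtain a where "a \<in> \<rat>" "\<phi> z < a" "a < \<phi> x" using Rats_dense_in_real[OF True] by auto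
            moreover obtain b where "b \<in> \<rat>" "\<phi> x < b" using Rats_dense_in_real[of "\<phi> x" "\<phi> x + 1"] by auto
            ultimately show ?thesis by auto
          next
            case False
            then have "\<phi> x < \<phi> z" using z by auto
            then obtain b where "b \<in> \<rat>" "b < \<phi> z" "\<phi> x < b" using Rats_dense_in_real by auto
            moreover obtain a where "a \<in> \<rat>" "a < \<phi> x" using Rats_dense_in_real[of "\<phi> x - 1" "\<phi> x"] by auto
            ultimately show ?thesis by auto
          qed
          then obtain a b where ab: "a \<in> \<rat>" "b \<in> \<rat>" "a < \<phi> x" "\<phi> x < b" "\<phi> z < a \<or> b < \<phi> z" by auto
          then have "{(\<phi>,a,b)} \<in> Ix" using z x SX by (auto simp: Ix_def I_def Fpow_def obox_def)
          then have "z \<in> box {(\<phi>,a,b)}" using K(2) z(2) by auto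
          then show False using ab(5) by (auto simp: box_def)
        qed
      qed
      then obtain T where T: "T \<in> I" "x \<in> obox T" "T \<in> Ix" "y \<notin> comp T x" by (auto simp: Ix_def)
      have "comp T x \<inter> comp T y = {}"
        using T(4) connected_component_of_disjoint[of "subtopology X (box T)" x y] unfolding comp_def disjnt_def by auto
      then show ?thesis using comp(3,5)[OF T(1,2)] comp(3,5)[OF T(1) yT[OF T(3)]] by auto
    qed
  qed fact+
qed

section \<open>Punctiform frontiers and the rim-weight\<close>

definition punctiform :: "'a topology \<Rightarrow> 'a set \<Rightarrow> bool" where
  "punctiform X F \<longleftrightarrow> (\<forall>K\<subseteq>F. subcontinuum X K \<longrightarrow> \<not> nondegenerate K)"

text \<open>
  Otherwise a non-degenerate continuum in each fibre over the open unit interval gives \<open>\<cc>\<close> disjoint ones.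
\<close>

lemma punctiform_fibre:
  fixes f :: "'a \<Rightarrow> real"
  assumes Sln: "Sln X <o ctwo ^c natLeq"
  obtains t where "0 < t" "t < 1" "punctiform X {x. f x = t}"
proof -
  have "\<exists>t\<in>{0<..<1}. punctiform X {x. f x = t}"
  proof (rule ccontr)
    assume "\<not> ?thesis"
    then have "\<exists>K. K \<subseteq> {x. f x = t} \<and> subcontinuum X K \<and> nondegenerate K" if "t \<in> {0<..<1}" for t
      using that unfolding punctiform_def by auto
    then obtain K where K: "\<And>t. t \<in> {0<..<1} \<Longrightarrow> K t \<subseteq> {x. f x = t} \<and> subcontinuum X (K t) \<and> nondegenerate (K t)"
      by metis
    have "|{0<..<1::real}| \<le>o Sln X"
    proof (rule card_of_index_le_Sln)
      show "K s \<inter> K t = {}" if "s \<in> {0<..<1}" "t \<in> {0<..<1}" "s \<noteq> t" for s t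
        using K[OF that(1)] K[OF that(2)] that(3) by auto
    qed (use K in auto)
    then have "ctwo ^c natLeq \<le>o Sln X" by (rule ordLeq_transitive[OF continuum_le_card_of_unit_interval])
    then show False using not_ordLess_ordLeq[OF Sln] by simp
  qed
  then show thesis using that by auto
qed

lemma neighbourhood_with_punctiform_frontier:
  assumes X: "continuum X" and Sln: "Sln X <o ctwo ^c natLeq" and U: "openin X U" and x: "x \<in> U"
  obtains V f t where "openin X V" "x \<in> V" "V \<subseteq> U" "continuous_map X euclideanreal f"
    "X frontier_of V \<subseteq> {z \<in> topspace X. f z = t}" "punctiform X {z. f z = t}"
proof -
  have xX: "x \<in> topspace X" using U x openin_subset by auto
  have "closedin X {x}" using X xX by (auto simp: continuum_def closedin_Hausdorff_sing_eq)
  moreover have "closedin X (topspace X - U)" using U by auto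
  moreover have "disjnt {x} (topspace X - U)" using x by auto
  ultimately obtain f where f: "continuous_map X euclideanreal f" "f ` {x} \<subseteq> {0}" "f ` (topspace X - U) \<subseteq> {1::real}"
    using Urysohn_lemma_alt[OF continuum_normal[OF X]] by metis
  obtain t where t: "0 < t" "t < 1" "punctiform X {z. f z = t}" using punctiform_fibre[OF Sln] by metis
  define V where "V = {z \<in> topspace X. f z \<in> {..<t}}"
  have op: "openin X V" unfolding V_def by (intro openin_continuous_map_preimage[OF f(1)]) auto
  have "closedin X {z \<in> topspace X. f z \<in> {..t}}" by (intro closedin_continuous_map_preimage[OF f(1)]) auto
  then have "X closure_of V \<subseteq> {z \<in> topspace X. f z \<in> {..t}}" by (rule closure_of_minimal[rotated]) (auto simp: V_def)
  then have "X frontier_of V \<subseteq> {z \<in> topspace X. f z = t}"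
    unfolding frontier_of_def interior_of_openin[OF op] by (auto simp: V_def)
  moreover have "V \<subseteq> U" using f(3) t by (auto simp: V_def)
  moreover have "x \<in> V" using f(2) t xX by (auto simp: V_def)
  ultimately show thesis using that op f(1) t(3) by metis
qed

text \<open>
  The frontiers of the base lie in fibres of single functions \<open>f\<close> that contain no non-degenerate continuum,
  so \<open>{f}\<close> is a light family for them.
\<close>

theorem rim_weight_le_Sln:
  assumes X: "continuum X" "nondegenerate (topspace X)" and Sln: "Sln X <o ctwo ^c natLeq"
  shows "rim_weight X \<le>o Sln X"
proof -
  have inf: "Cinfinite (Sln X)" by (rule Cinfinite_Sln[OF X])
  define \<B> where "\<B> = {V. openin X V \<and> (\<exists>f t. continuous_map X euclideanreal f \<and>
    X frontier_of V \<subseteq> {z \<in> topspace X. f z = t} \<and> punctiform X {z. f z = t})}"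
  have B: "base_of X \<B>"
    unfolding base_of_iff
  proof (intro conjI ballI allI impI)
    fix U x assume "openin X U" "x \<in> U"
    obtain V f t where "openin X V" "x \<in> V" "V \<subseteq> U" "continuous_map X euclideanreal f"
        "X frontier_of V \<subseteq> {z \<in> topspace X. f z = t}" "punctiform X {z. f z = t}"
      by (rule neighbourhood_with_punctiform_frontier[OF X(1) Sln \<open>openin X U\<close> \<open>x \<in> U\<close>])
    then have "V \<in> \<B>" unfolding \<B>_def by auto
    then show "\<exists>B\<in>\<B>. x \<in> B \<and> B \<subseteq> U" using \<open>x \<in> V\<close> \<open>V \<subseteq> U\<close> by auto
  qed (auto simp: \<B>_def)
  have w: "weight (subtopology X (X frontier_of V)) \<le>o Sln X" if VB: "V \<in> \<B>" for V
  proof -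
    obtain f t where V: "openin X V" "continuous_map X euclideanreal f"
      "X frontier_of V \<subseteq> {z \<in> topspace X. f z = t}" "punctiform X {z. f z = t}" using VB by (auto simp: \<B>_def)
    show ?thesis
    proof (rule weight_le_of_light[OF X inf _ _ _ closedin_frontier_of, of "{f}"])
      show "Sln X \<le>o Sln X" using inf by (simp add: ordLeq_refl)
      show "|{f}| \<le>o Sln X" by (rule card_of_countable_bound[OF inf]) auto
      show "\<exists>\<phi>\<in>{f}. \<exists>z\<in>K. \<phi> z \<noteq> \<phi> x" if "subcontinuum X K" "nondegenerate K" "x \<in> X frontier_of V" "x \<in> K" for K x
        using that V(3,4) unfolding punctiform_def by (auto simp: subset_iff)
    qed (use V in auto)
  qed
  show ?thesis by (rule rim_weight_le[OF B w Card_order_Sln])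
qed

section \<open>The covering dimension\<close>

text \<open>
  If \<open>K\<close> is not inside \<open>A\<close>, then \<open>K - A\<close> contains a non-degenerate continuum, which is inside \<open>B\<close>.
\<close>

lemma punctiform_Un:
  assumes X: "continuum X" and A: "closedin X A" "punctiform X A" and B: "punctiform X B"
  shows "punctiform X (A \<union> B)"
  unfolding punctiform_def
proof (intro allI impI notI)
  fix K assume K: "K \<subseteq> A \<union> B" "subcontinuum X K" "nondegenerate K"
  then have "\<not> K \<subseteq> A" using A(2) by (auto simp: punctiform_def)
  then obtain L where "subcontinuum X L" "nondegenerate L" "L \<subseteq> K" "L \<inter> A = {}"
    using subcontinuum_avoiding[OF X K(2,3) A(1)] by metis
  moreover from this K have "L \<subseteq> B" by auto
  ultimately show False using B by (auto simp: punctiform_def)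
qed

lemma punctiform_Union:
  assumes X: "continuum X" and "finite \<F>" "\<And>F. F \<in> \<F> \<Longrightarrow> closedin X F \<and> punctiform X F"
  shows "punctiform X (\<Union>\<F>)"
  using assms(2,3)
proof (induction \<F>)
  case empty
  then show ?case by (auto simp: punctiform_def nondegenerate_def)
next
  case (insert F \<F>)
  then show ?case using punctiform_Un[OF X, of F "\<Union>\<F>"] by auto
qed

text \<open>
  The component of \<open>F\<close> at \<open>x\<close> is \<open>{x}\<close>, so \<open>x\<close> has arbitrarily small clopen neighbourhoods in \<open>F\<close>.
  The pair \<open>(G, H)\<close> extends such a clopen partition of \<open>F\<close> to \<open>X\<close>.
\<close>

lemma punctiform_clopen_neighbourhood:
  assumes X: "compact_space X" "Hausdorff_space X" and F: "closedin X F" "punctiform X F"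
    and U: "openin X U" and x: "x \<in> F" "x \<in> U"
  obtains G H where "openin X G" "openin X H" "G \<inter> H = {}" "x \<in> G" "G \<subseteq> U" "F \<subseteq> G \<union> H"
proof -
  let ?Y = "subtopology X F"
  have FX: "F \<subseteq> topspace X" using F closedin_subset by auto
  have Y: "compact_space ?Y" "Hausdorff_space ?Y"
    using X F by (auto simp: compact_space_subtopology closedin_compact_space Hausdorff_space_subtopology)
  \<comment> \<open>No connected subset of \<open>F\<close> joins \<open>x\<close> to a point outside \<open>U\<close>.\<close>
  have "separated_between ?Y {x} (F - U)"
  proof (rule cut_wire_fence_theorem[OF Y])
    show "closedin ?Y {x}" using Y x FX by (auto simp: closedin_Hausdorff_sing_eq)
    show "closedin ?Y (F - U)" using F U by (simp add: closedin_closed_subtopology closedin_diff)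
    fix C assume C: "connectedin ?Y C"
    show "disjnt C {x} \<or> disjnt C (F - U)"
    proof (rule ccontr)
      assume "\<not> ?thesis"
      then obtain y where y: "x \<in> C" "y \<in> C" "y \<in> F" "y \<notin> U" by (auto simp: disjnt_iff)
      let ?K = "connected_component_of_set ?Y x"
      have "y \<in> ?K" using C y by (auto simp: connected_component_of_def)
      moreover note K = subcontinuum_component[OF X F(1) x(1)]
      ultimately have "nondegenerate ?K" using y x unfolding nondegenerate_def by metis
      then show False using K F(2) by (auto simp: punctiform_def)
    qed
  qed
  then obtain P Q where PQ: "closedin ?Y P" "closedin ?Y Q" "P \<union> Q = topspace ?Y"
      "disjnt P Q" "{x} \<subseteq> P" "F - U \<subseteq> Q"
    unfolding separated_between_alt by metis
  then have "closedin X P" "closedin X Q" using F closedin_trans_full by blast+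
  then obtain G H where GH: "openin X G" "openin X H" "P \<subseteq> G" "Q \<subseteq> H" "disjnt G H"
    using compact_Hausdorff_or_regular_imp_normal_space[OF X(1)] X(2) PQ(4) unfolding normal_space_def by metis
  have "P \<union> Q = F" using PQ(3) FX by auto
  show thesis
  proof
    show "openin X (G \<inter> U)" "openin X H" using GH U by auto
    show "G \<inter> U \<inter> H = {}" using GH(5) by (auto simp: disjnt_iff)
    show "x \<in> G \<inter> U" using PQ(5) GH(3) x by auto
    have "P \<subseteq> U" using PQ(4,6) \<open>P \<union> Q = F\<close> by (auto simp: disjnt_iff)
    then show "F \<subseteq> G \<inter> U \<union> H" using GH(3,4) \<open>P \<union> Q = F\<close> by auto
  qed auto
qed

text \<open>
  The usual device of subtracting from each set the earlier ones, arranged so that the results stay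
  open: instead of removing \<open>G\<close> one intersects with \<open>H\<close>, and no point of \<open>E\<close> is lost.
  It serves twice for the covering dimension, for the union of the frontiers and
  for its complement.
\<close>

lemma disjoint_open_refinement:
  assumes "finite \<G>" and "\<And>G H. (G, H) \<in> \<G> \<Longrightarrow> openin X G \<and> openin X H \<and> G \<inter> H = {} \<and> E \<subseteq> G \<union> H"
    and "E \<subseteq> \<Union>(fst ` \<G>)"
  shows "\<exists>\<O>. finite \<O> \<and> disjoint \<O> \<and> (\<forall>N\<in>\<O>. openin X N \<and> (\<exists>G\<in>fst ` \<G>. N \<subseteq> G)) \<and> E \<subseteq> \<Union>\<O>"
  using assms
proof (induction \<G> arbitrary: E)
  case empty
  then show ?case by (intro exI[of _ "{}"]) auto
next
  case (insert p \<G>)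
  obtain G H where p: "p = (G, H)" by (cases p)
  have GH: "openin X G" "openin X H" "G \<inter> H = {}" "E \<subseteq> G \<union> H" using insert.prems(1)[of G H] p by auto
  have "\<exists>\<O>. finite \<O> \<and> disjoint \<O> \<and> (\<forall>N\<in>\<O>. openin X N \<and> (\<exists>G\<in>fst ` \<G>. N \<subseteq> G)) \<and> E - G \<subseteq> \<Union>\<O>"
  proof (rule insert.IH)
    show "E - G \<subseteq> \<Union>(fst ` \<G>)" using insert.prems(2) p by auto
    fix G' H' assume "(G', H') \<in> \<G>"
    then show "openin X G' \<and> openin X H' \<and> G' \<inter> H' = {} \<and> E - G \<subseteq> G' \<union> H'" using insert.prems(1)[of G' H'] by auto
  qed
  then obtain \<O> where N: "finite \<O>" "disjoint \<O>" "\<And>N. N \<in> \<O> \<Longrightarrow> openin X N \<and> (\<exists>G\<in>fst ` \<G>. N \<subseteq> G)"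
    "E - G \<subseteq> \<Union>\<O>" by metis
  let ?\<O> = "insert G ((\<lambda>N. N \<inter> H) ` \<O>)"
  have "finite ?\<O>" using N(1) by auto
  moreover have "disjoint ?\<O>"
  proof -
    have "disjoint ((\<lambda>N. N \<inter> H) ` \<O>)" using N(2) unfolding disjoint_def by auto
    then show ?thesis using GH(3) by (auto simp: pairwise_insert disjnt_def)
  qed
  moreover have "\<forall>N\<in>?\<O>. openin X N \<and> (\<exists>G\<in>fst ` insert p \<G>. N \<subseteq> G)"
  proof
    fix N assume "N \<in> ?\<O>"
    then consider "N = G" | N' where "N' \<in> \<O>" "N = N' \<inter> H" by auto
    then show "openin X N \<and> (\<exists>G\<in>fst ` insert p \<G>. N \<subseteq> G)"
    proof cases
      case 2
      then obtain G' where "G' \<in> fst ` \<G>" "N' \<subseteq> G'" using N(3) by metis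
      then show ?thesis using 2 N(3)[OF 2(1)] GH by auto
    qed (use GH p in auto)
  qed
  moreover have "E \<subseteq> \<Union>?\<O>"
  proof
    fix x assume x: "x \<in> E"
    show "x \<in> \<Union>?\<O>"
    proof (cases "x \<in> G")
      case False
      then obtain N where "N \<in> \<O>" "x \<in> N" using x N(4) by auto
      moreover have "x \<in> H" using False x GH(4) by auto
      ultimately show ?thesis by auto
    qed simp
  qed
  ultimately show ?case by (intro exI[of _ ?\<O>]) simp
qed

lemma card_disjoint_point_le_1:
  assumes "disjoint \<O>" shows "card {N \<in> \<O>. x \<in> N} \<le> 1"
proof -
  have "N = N'" if "N \<in> {N \<in> \<O>. x \<in> N}" "N' \<in> {N \<in> \<O>. x \<in> N}" for N N'
    using that assms unfolding disjoint_def by (metis (mono_tags, lifting) disjoint_iff mem_Collect_eq)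
  then have "{N \<in> \<O>. x \<in> N} = {} \<or> (\<exists>N. {N \<in> \<O>. x \<in> N} = {N})" by blast
  then show ?thesis
  proof (elim disjE exE)
    assume e: "{N \<in> \<O>. x \<in> N} = {}"
    show ?thesis unfolding e by simp
  next
    fix N assume e: "{N \<in> \<O>. x \<in> N} = {N}"
    show ?thesis unfolding e by simp
  qed
qed

text \<open>
  One disjoint family of small open sets covers the union \<open>F\<close> of the frontiers, another one covers the
  complement of \<open>F\<close>.
\<close>

theorem covering_dim_le_1:
  assumes X: "continuum X" and Sln: "Sln X <o ctwo ^c natLeq"
  shows "covering_dim_le X 1"
  unfolding covering_dim_le_def
proof (intro allI impI)
  have X': "compact_space X" "Hausdorff_space X" using X by (auto simp: continuum_def)
  fix \<U> assume "finite \<U> \<and> open_cover X \<U>"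
  then have U: "\<And>U. U \<in> \<U> \<Longrightarrow> openin X U" "\<Union>\<U> = topspace X" by (auto simp: open_cover_def)
  define \<W> where "\<W> = {V. openin X V \<and> (\<exists>U\<in>\<U>. V \<subseteq> U) \<and> punctiform X (X frontier_of V)}"
  have "topspace X \<subseteq> \<Union>\<W>"
  proof
    fix x assume "x \<in> topspace X"
    then obtain U where xU: "U \<in> \<U>" "x \<in> U" using U(2) by auto
    obtain V f and t :: real where V: "openin X V" "x \<in> V" "V \<subseteq> U" "X frontier_of V \<subseteq> {z \<in> topspace X. f z = t}"
      "punctiform X {z. f z = t}"
      by (rule neighbourhood_with_punctiform_frontier[OF X Sln U(1)[OF xU(1)] xU(2)])
    have "punctiform X (X frontier_of V)" using V(4,5) by (auto simp: punctiform_def subset_iff)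
    then have "V \<in> \<W>" using V(1,3) xU(1) by (auto simp: \<W>_def)
    then show "x \<in> \<Union>\<W>" using V(2) by auto
  qed
  moreover have "compactin X (topspace X)" using X'(1) by (simp add: compact_space_def)
  ultimately have "\<exists>\<V>. finite \<V> \<and> \<V> \<subseteq> \<W> \<and> topspace X \<subseteq> \<Union>\<V>"
    by (intro compactinD) (auto simp: \<W>_def)
  then obtain \<V> where V: "finite \<V>" "\<V> \<subseteq> \<W>" "topspace X \<subseteq> \<Union>\<V>" by metis
  have Vop: "openin X V" "\<exists>U\<in>\<U>. V \<subseteq> U" "punctiform X (X frontier_of V)" if "V \<in> \<V>" for V
    using that V(2) by (auto simp: \<W>_def)
  define F where "F = \<Union>((\<lambda>V. X frontier_of V) ` \<V>)"
  have F: "closedin X F" unfolding F_def using V(1) by (intro closedin_Union) (auto simp: closedin_frontier_of)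
  have pF: "punctiform X F"
    unfolding F_def using V(1) Vop by (intro punctiform_Union X) (auto simp: closedin_frontier_of)

  define \<G> where "\<G> = {(G, H). openin X G \<and> openin X H \<and> G \<inter> H = {} \<and> F \<subseteq> G \<union> H \<and> (\<exists>U\<in>\<U>. G \<subseteq> U)}"
  have "F \<subseteq> \<Union>(fst ` \<G>)"
  proof
    fix x assume x: "x \<in> F"
    then obtain U where xU: "U \<in> \<U>" "x \<in> U" using U(2) closedin_subset[OF F] by auto
    obtain G H where "openin X G" "openin X H" "G \<inter> H = {}" "x \<in> G" "G \<subseteq> U" "F \<subseteq> G \<union> H"
      by (rule punctiform_clopen_neighbourhood[OF X' F pF U(1)[OF xU(1)] x xU(2)])
    then have "(G, H) \<in> \<G>" "x \<in> G" using xU(1) by (auto simp: \<G>_def)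
    then show "x \<in> \<Union>(fst ` \<G>)" by force
  qed
  moreover have "compactin X F" using X'(1) F closedin_compact_space by metis
  ultimately have "\<exists>\<F>. finite \<F> \<and> \<F> \<subseteq> fst ` \<G> \<and> F \<subseteq> \<Union>\<F>"
    by (intro compactinD) (auto simp: \<G>_def)
  then obtain \<G>' where G': "finite \<G>'" "\<G>' \<subseteq> \<G>" "F \<subseteq> \<Union>(fst ` \<G>')" by (metis finite_subset_image)
  have "\<exists>\<O>. finite \<O> \<and> disjoint \<O> \<and> (\<forall>N\<in>\<O>. openin X N \<and> (\<exists>G\<in>fst ` \<G>'. N \<subseteq> G)) \<and> F \<subseteq> \<Union>\<O>"
    by (rule disjoint_open_refinement[OF G'(1) _ G'(3)]) (use G'(2) in \<open>auto simp: \<G>_def\<close>)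
  then obtain \<O>1 where O1: "finite \<O>1" "disjoint \<O>1" "\<And>N. N \<in> \<O>1 \<Longrightarrow> openin X N \<and> (\<exists>G\<in>fst ` \<G>'. N \<subseteq> G)" "F \<subseteq> \<Union>\<O>1"
    by metis
  have sub1: "\<exists>U\<in>\<U>. N \<subseteq> U" if N: "N \<in> \<O>1" for N
  proof -
    obtain G H where "(G, H) \<in> \<G>'" "N \<subseteq> G" using O1(3)[OF N] by auto
    then have "(G, H) \<in> \<G>" using G'(2) by auto
    then obtain U where "U \<in> \<U>" "G \<subseteq> U" by (auto simp: \<G>_def)
    then show ?thesis using \<open>N \<subseteq> G\<close> by auto
  qed

  \<comment> \<open>Off its frontier, \<open>V\<close> is complementary to the exterior of \<open>V\<close>, and both are open.\<close>
  let ?p = "\<lambda>V. (V, topspace X - X closure_of V)"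
  have "\<exists>\<O>. finite \<O> \<and> disjoint \<O> \<and> (\<forall>N\<in>\<O>. openin X N \<and> (\<exists>G\<in>fst ` ?p ` \<V>. N \<subseteq> G)) \<and> topspace X - F \<subseteq> \<Union>\<O>"
  proof (rule disjoint_open_refinement)
    show "finite (?p ` \<V>)" using V(1) by simp
    show "topspace X - F \<subseteq> \<Union>(fst ` ?p ` \<V>)" using V(3) by auto
    fix G H assume "(G, H) \<in> ?p ` \<V>"
    then have G: "G \<in> \<V>" "H = topspace X - X closure_of G" by auto
    have "G \<subseteq> X closure_of G" using Vop(1)[OF G(1)] closure_of_subset openin_subset by metis
    moreover have "X closure_of G \<subseteq> F \<union> G"
      using G(1) Vop(1)[OF G(1)] by (auto simp: F_def frontier_of_def interior_of_openin)
    ultimately show "openin X G \<and> openin X H \<and> G \<inter> H = {} \<and> topspace X - F \<subseteq> G \<union> H"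
      using Vop(1)[OF G(1)] unfolding G(2) by auto
  qed
  then obtain \<O>2 where O2: "finite \<O>2" "disjoint \<O>2" "\<And>N. N \<in> \<O>2 \<Longrightarrow> openin X N \<and> (\<exists>G\<in>fst ` ?p ` \<V>. N \<subseteq> G)"
    "topspace X - F \<subseteq> \<Union>\<O>2" by metis
  have sub2: "\<exists>U\<in>\<U>. N \<subseteq> U" if N: "N \<in> \<O>2" for N
  proof -
    obtain V where V': "V \<in> \<V>" "N \<subseteq> V" using O2(3)[OF N] by auto
    then obtain U where "U \<in> \<U>" "V \<subseteq> U" using Vop(2) by metis
    then show ?thesis using V'(2) by auto
  qed
  show "\<exists>\<V>. finite \<V> \<and> open_cover X \<V> \<and> (\<forall>V\<in>\<V>. \<exists>U\<in>\<U>. V \<subseteq> U) \<and>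
      (\<forall>x\<in>topspace X. int (card {V \<in> \<V>. x \<in> V}) \<le> 1 + 1)"
  proof (intro exI conjI ballI)
    show "finite (\<O>1 \<union> \<O>2)" using O1(1) O2(1) by simp
    have "\<Union>(\<O>1 \<union> \<O>2) \<subseteq> topspace X" using O1(3) O2(3) openin_subset by blast
    then show "open_cover X (\<O>1 \<union> \<O>2)" using O1(3,4) O2(3,4) by (auto simp: open_cover_def)
    show "\<exists>U\<in>\<U>. V \<subseteq> U" if "V \<in> \<O>1 \<union> \<O>2" for V using that sub1 sub2 by auto
    fix x
    have "{V \<in> \<O>1 \<union> \<O>2. x \<in> V} = {V \<in> \<O>1. x \<in> V} \<union> {V \<in> \<O>2. x \<in> V}" by auto
    then have "card {V \<in> \<O>1 \<union> \<O>2. x \<in> V} \<le> card {V \<in> \<O>1. x \<in> V} + card {V \<in> \<O>2. x \<in> V}"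
      using card_Un_le by metis
    then show "int (card {V \<in> \<O>1 \<union> \<O>2. x \<in> V}) \<le> 1 + 1"
      using card_disjoint_point_le_1[OF O1(2), of x] card_disjoint_point_le_1[OF O2(2), of x] by linarith
  qed
qed

section \<open>The weight and the successor of the Suslinian number\<close>

definition fibre :: "'a topology \<Rightarrow> ('a \<Rightarrow> real) set \<Rightarrow> 'a \<Rightarrow> 'a set" where
  "fibre X \<Phi> x = {z \<in> topspace X. \<forall>\<phi>\<in>\<Phi>. \<phi> z = \<phi> x}"

definition fibre_component :: "'a topology \<Rightarrow> ('a \<Rightarrow> real) set \<Rightarrow> 'a \<Rightarrow> 'a set" where
  "fibre_component X \<Phi> x = connected_component_of_set (subtopology X (fibre X \<Phi> x)) x"

definition nonconstant_on :: "'a topology \<Rightarrow> 'a set \<Rightarrow> ('a \<Rightarrow> real) \<Rightarrow> bool" where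
  "nonconstant_on X L \<phi> \<longleftrightarrow> continuous_map X euclideanreal \<phi> \<and> (\<exists>x\<in>L. \<exists>y\<in>L. \<phi> x \<noteq> \<phi> y)"

text \<open>
  One function for each non-degenerate component of a fibre of \<open>\<Phi>\<close>, chosen not to be constant on it.
\<close>

definition splitting :: "'a topology \<Rightarrow> ('a \<Rightarrow> real) set \<Rightarrow> ('a \<Rightarrow> real) set" where
  "splitting X \<Phi> = (\<lambda>L. SOME \<phi>. nonconstant_on X L \<phi>) `
     {L. subcontinuum X L \<and> nondegenerate L \<and> (\<exists>x\<in>topspace X. L = fibre_component X \<Phi> x)}"

lemma nonconstant_exists:
  assumes X: "continuum X" and L: "L \<subseteq> topspace X" "nondegenerate L"
  shows "nonconstant_on X L (SOME \<phi>. nonconstant_on X L \<phi>)"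
proof (rule someI_ex[of "nonconstant_on X L"])
  obtain x y where xy: "x \<in> L" "y \<in> L" "x \<noteq> y" using L by (auto simp: nondegenerate_def)
  have "closedin X {x}" "closedin X {y}"
    using X xy L by (auto simp: continuum_def closedin_Hausdorff_sing_eq)
  moreover have "disjnt {x} {y}" using xy by auto
  ultimately obtain f where "continuous_map X euclideanreal f" "f ` {x} \<subseteq> {0}" "f ` {y} \<subseteq> {1::real}"
    using Urysohn_lemma_alt[OF continuum_normal[OF X]] by metis
  then show "\<exists>\<phi>. nonconstant_on X L \<phi>" using xy unfolding nonconstant_on_def by (intro exI[of _ f]) force
qed

lemma splitting_continuous:
  assumes "continuum X" "\<phi> \<in> splitting X \<Phi>" shows "continuous_map X euclideanreal \<phi>"
proof -
  obtain L where "subcontinuum X L" "nondegenerate L" "\<phi> = (SOME \<phi>. nonconstant_on X L \<phi>)"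
    using assms(2) by (auto simp: splitting_def)
  then show ?thesis using nonconstant_exists[OF assms(1), of L] by (simp add: subcontinuum_def nonconstant_on_def)
qed

text \<open>
  The components of all fibres of \<open>\<Phi>\<close> form a disjoint family, whatever the size of \<open>\<Phi>\<close>.
\<close>

lemma card_of_splitting_le_Sln: "|splitting X \<Phi>| \<le>o Sln X"
  unfolding splitting_def
proof (rule card_of_image_bound, rule card_of_le_Sln)
  let ?\<C> = "{L. subcontinuum X L \<and> nondegenerate L \<and> (\<exists>x\<in>topspace X. L = fibre_component X \<Phi> x)}"
  have "fibre_component X \<Phi> x = fibre_component X \<Phi> y"
    if z: "z \<in> fibre_component X \<Phi> x" "z \<in> fibre_component X \<Phi> y" for x y z
  proof -
    have "z \<in> fibre X \<Phi> x" "z \<in> fibre X \<Phi> y"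
      using z connected_component_of_subset_topspace unfolding fibre_component_def by fastforce+
    then have "\<forall>\<phi>\<in>\<Phi>. \<phi> x = \<phi> y" unfolding fibre_def by force
    then have "fibre X \<Phi> x = fibre X \<Phi> y" by (auto simp: fibre_def)
    then show ?thesis
      using z connected_component_of_eq_overlap[of "subtopology X (fibre X \<Phi> x)" x y]
      unfolding fibre_component_def by auto
  qed
  then show "disjoint ?\<C>" unfolding disjoint_def by blast
qed auto

text \<open>
  The recursion runs over the well-order \<open>?r\<close> of type \<open>\<kappa>\<^sup>+\<close>: the family \<open>\<Phi> a\<close> splits the fibre
  components of all earlier families.  A continuum \<open>K\<close> on which the union \<open>\<Psi>\<close> is constant lies in
  the component \<open>L a\<close> of the fibre of \<open>\<Phi> a\<close> at \<open>x\<close>, for every \<open>a\<close>.  The function \<open>\<psi> a\<close> splits \<open>L a\<close> but is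
  constant on each later \<open>L b\<close>, so continua in \<open>L a\<close> off the fibre \<open>M a\<close> of \<open>\<psi> a\<close> are disjoint for
  different \<open>a\<close>.  There are \<open>\<kappa>\<^sup>+\<close> of them, which exceeds the Suslinian number.
\<close>

theorem weight_le_cardSuc_Sln:
  assumes X: "continuum X" "nondegenerate (topspace X)"
  shows "weight X \<le>o cardSuc (Sln X)"
proof -
  let ?r = "cardSuc (Sln X)"
  have X': "compact_space X" "Hausdorff_space X" using X by (auto simp: continuum_def)
  have cSln: "Card_order (Sln X)" by (rule Card_order_Sln)
  have inf: "Cinfinite ?r" using Cinfinite_Sln[OF X] by (rule Cinfinite_cardSuc)
  have r: "Card_order ?r" "Well_order ?r" using cSln cardSuc_Card_order card_order_on_def by blast+
  have Sln_r: "Sln X \<le>o ?r" using cSln by (rule cardSuc_ordLeq)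
  have Field_r: "|Field ?r| \<le>o ?r" using r(1) card_of_Field_ordIso ordIso_iff_ordLeq by blast
  have wf: "wf (?r - Id)" using r(2) by (simp add: well_order_on_def)
  define \<Phi> where "\<Phi> = wfrec (?r - Id) (\<lambda>h a. \<Union>b\<in>underS ?r a. splitting X (h b))"
  have \<Phi>_eq: "\<Phi> a = (\<Union>b\<in>underS ?r a. splitting X (\<Phi> b))" for a
  proof -
    have "\<Phi> a = (\<Union>b\<in>underS ?r a. splitting X (cut \<Phi> (?r - Id) a b))"
      unfolding \<Phi>_def by (subst wfrec[OF wf]) simp
    moreover have "cut \<Phi> (?r - Id) a b = \<Phi> b" if "b \<in> underS ?r a" for b
      using that by (simp add: cut_apply underS_def)
    ultimately show ?thesis by simp
  qed
  define \<Psi> where "\<Psi> = (\<Union>a\<in>Field ?r. splitting X (\<Phi> a))"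
  have sub\<Psi>: "\<Phi> a \<subseteq> \<Psi>" for a
    unfolding \<Psi>_def by (subst \<Phi>_eq) (auto simp: underS_def Field_def)
  have cont\<Psi>: "continuous_map X euclideanreal \<phi>" if "\<phi> \<in> \<Psi>" for \<phi>
    using that splitting_continuous[OF X(1)] by (auto simp: \<Psi>_def)
  have "|\<Psi>| \<le>o ?r"
    unfolding \<Psi>_def
    by (intro UNION_Cinfinite_bound inf Field_r ballI ordLeq_transitive[OF card_of_splitting_le_Sln Sln_r])
  have closed_fibre: "closedin X (fibre X (\<Phi> a) x)" for a x
  proof -
    have "closedin X (\<Inter>(insert (topspace X) ((\<lambda>\<phi>. {z \<in> topspace X. \<phi> z \<in> {\<phi> x}}) ` \<Phi> a)))"
    proof (rule closedin_Inter)
      fix C assume "C \<in> insert (topspace X) ((\<lambda>\<phi>. {z \<in> topspace X. \<phi> z \<in> {\<phi> x}}) ` \<Phi> a)"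
      then consider "C = topspace X" | \<phi> where "\<phi> \<in> \<Psi>" "C = {z \<in> topspace X. \<phi> z \<in> {\<phi> x}}" using sub\<Psi> by auto
      then show "closedin X C"
      proof cases
        case 2
        then show ?thesis using closedin_continuous_map_preimage[OF cont\<Psi>[OF 2(1)], of "{\<phi> x}"] by simp
      qed simp
    qed simp
    moreover have "\<Inter>(insert (topspace X) ((\<lambda>\<phi>. {z \<in> topspace X. \<phi> z \<in> {\<phi> x}}) ` \<Phi> a)) = fibre X (\<Phi> a) x"
      by (auto simp: fibre_def)
    ultimately show ?thesis by simp
  qed
  have light: "\<exists>\<phi>\<in>\<Psi>. \<exists>z\<in>K. \<phi> z \<noteq> \<phi> x" if K: "subcontinuum X K" "nondegenerate K" "x \<in> K" for K x
  proof (rule ccontr)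
    assume "\<not> ?thesis"
    then have const: "\<phi> z = \<phi> x" if "\<phi> \<in> \<Psi>" "z \<in> K" for \<phi> z using that by metis
    have KX: "K \<subseteq> topspace X" "connectedin X K" using K(1) subcontinuum_iff[OF X'(2)] by (auto simp: subcontinuum_def)
    define L where "L a = fibre_component X (\<Phi> a) x" for a
    define \<psi> where "\<psi> a = (SOME \<phi>. nonconstant_on X (L a) \<phi>)" for a
    define M where "M a = {z \<in> topspace X. \<psi> a z \<in> {\<psi> a x}}" for a
    have xF: "x \<in> fibre X (\<Phi> a) x" for a using K(3) KX(1) by (auto simp: fibre_def)
    have L: "subcontinuum X (L a)" "L a \<subseteq> fibre X (\<Phi> a) x" for a
      unfolding L_def fibre_component_def by (rule subcontinuum_component[OF X' closed_fibre xF])+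
    have "K \<subseteq> L a" for a
    proof -
      have "K \<subseteq> fibre X (\<Phi> a) x" using const sub\<Psi> KX(1) by (auto simp: fibre_def)
      then have "connectedin (subtopology X (fibre X (\<Phi> a) x)) K" using KX(2) by (simp add: connectedin_subtopology)
      then show ?thesis
        unfolding L_def fibre_component_def using K(3) by (rule connected_component_of_maximal)
    qed
    then have ndL: "nondegenerate (L a)" for a using K(2) unfolding nondegenerate_def by blast
    have LX: "L a \<subseteq> topspace X" for a using L(1) by (simp add: subcontinuum_def)
    have \<psi>: "nonconstant_on X (L a) (\<psi> a)" for a unfolding \<psi>_def by (rule nonconstant_exists[OF X(1) LX ndL])
    have "\<psi> a \<in> splitting X (\<Phi> a)" for a
      unfolding splitting_def \<psi>_def using L(1)[of a] ndL[of a] KX(1) K(3) by (intro imageI) (auto simp: L_def)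
    then have \<psi>\<Phi>: "\<psi> a \<in> \<Phi> b" if "a \<in> underS ?r b" for a b using that by (subst \<Phi>_eq) auto
    have clM: "closedin X (M a)" for a
      unfolding M_def using \<psi>[of a] by (intro closedin_continuous_map_preimage) (auto simp: nonconstant_on_def)
    have "\<not> L a \<subseteq> M a" for a
    proof
      assume "L a \<subseteq> M a"
      then have "\<psi> a z = \<psi> a x" if "z \<in> L a" for z using that by (auto simp: M_def)
      then show False using \<psi>[of a] unfolding nonconstant_on_def by metis
    qed
    then have "\<exists>C. subcontinuum X C \<and> nondegenerate C \<and> C \<subseteq> L a \<and> C \<inter> M a = {}" for a
      using subcontinuum_avoiding[OF X(1) L(1) ndL clM] by metis
    then obtain C where C: "\<And>a. subcontinuum X (C a) \<and> nondegenerate (C a) \<and> C a \<subseteq> L a \<and> C a \<inter> M a = {}" by metis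
    have less: "C a \<inter> C b = {}" if "a \<in> underS ?r b" for a b
    proof -
      have "L b \<subseteq> M a" using L(2)[of b] \<psi>\<Phi>[OF that] by (auto simp: fibre_def M_def)
      then show ?thesis using C[of a] C[of b] by auto
    qed
    have "|Field ?r| \<le>o Sln X"
    proof (rule card_of_index_le_Sln)
      fix a b assume ab: "a \<in> Field ?r" "b \<in> Field ?r" "a \<noteq> b"
      then have "a \<in> underS ?r b \<or> b \<in> underS ?r a"
        using r(2) by (auto simp: underS_def well_order_on_def linear_order_on_def total_on_def)
      then show "C a \<inter> C b = {}" using less by blast
    qed (use C in auto)
    then have "?r \<le>o Sln X" by (rule ordIso_ordLeq_trans[OF ordIso_symmetric[OF card_of_Field_ordIso[OF r(1)]]])
    then show False using not_ordLess_ordLeq[OF cardSuc_greater[OF cSln]] by simp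
  qed
  have "weight (subtopology X (topspace X)) \<le>o ?r"
    by (rule weight_le_of_light[OF X inf Sln_r cont\<Psi> \<open>|\<Psi>| \<le>o ?r\<close>]) (use light in auto)
  then show ?thesis by simp
qed

section \<open>Continua with at most one point and the theorem\<close>

lemma degenerate_case:
  assumes X: "continuum X" and deg: "\<not> nondegenerate (topspace X)"
  shows "rim_weight X \<le>o Sln X" "Sln X \<le>o hereditary_lindelof_number (expc_space X)"
    "hereditary_lindelof_number (expc_space X) \<le>o weight X" "weight X \<le>o cardSuc (Sln X)"
proof -
  have no: "\<C> = {}" if "\<forall>K\<in>\<C>. subcontinuum X K \<and> nondegenerate K" for \<C>
    using that deg unfolding subcontinuum_def nondegenerate_def by blast
  have zero: "|{}| \<le>o r" if "Card_order r" for r :: "'b rel" using that by (rule Card_order_empty)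
  show "Sln X \<le>o hereditary_lindelof_number (expc_space X)"
  proof (rule Sln_least[OF Card_order_hereditary_lindelof_number])
    fix \<C> assume "\<forall>K\<in>\<C>. subcontinuum X K \<and> nondegenerate K"
    then show "|\<C>| \<le>o hereditary_lindelof_number (expc_space X)"
      using no zero[OF Card_order_hereditary_lindelof_number] by metis
  qed
  have base: "base_of X {topspace X}"
    unfolding base_of_iff
  proof (intro conjI ballI allI impI)
    fix U x assume U: "openin X U" "x \<in> U"
    have x: "x \<in> topspace X" using U openin_subset by auto
    have "z = x" if "z \<in> topspace X" for z using deg that x unfolding nondegenerate_def by metis
    then have "topspace X \<subseteq> U" using U(2) by (metis subsetI)
    then show "\<exists>B\<in>{topspace X}. x \<in> B \<and> B \<subseteq> U" using x by blast
  qed auto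
  have less: "Sln X <o cardSuc (Sln X)" by (rule cardSuc_greater[OF Card_order_Sln])
  have r: "Card_order (cardSuc (Sln X))" by (rule cardSuc_Card_order[OF Card_order_Sln])
  have Field_r: "|Field (cardSuc (Sln X))| =o cardSuc (Sln X)" by (rule card_of_Field_ordIso[OF r])
  have "Field (cardSuc (Sln X)) \<noteq> {}"
  proof
    assume "Field (cardSuc (Sln X)) = {}"
    then have "|Field (cardSuc (Sln X))| \<le>o Sln X" using zero[OF Card_order_Sln] by simp
    then have "cardSuc (Sln X) \<le>o Sln X" by (rule ordIso_ordLeq_trans[OF ordIso_symmetric[OF Field_r]])
    then show False using not_ordLess_ordLeq[OF less] by simp
  qed
  then have "|{topspace X}| \<le>o |Field (cardSuc (Sln X))|" by (rule card_of_singl_ordLeq)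
  then have "|{topspace X}| \<le>o cardSuc (Sln X)" by (rule ordLeq_ordIso_trans[OF _ Field_r])
  then show "weight X \<le>o cardSuc (Sln X)" by (rule ordLeq_transitive[OF weight_le[OF base]])
  have "base_of (subtopology X {}) {}" by (auto simp: base_of_iff)
  then have w0: "weight (subtopology X {}) \<le>o Sln X"
    by (rule ordLeq_transitive[OF weight_le zero[OF Card_order_Sln]])
  show "rim_weight X \<le>o Sln X"
    by (rule rim_weight_le[OF base _ Card_order_Sln]) (use w0 in simp)
  let ?E = "expc_space X"
  have single: "K = topspace X" "topspace X \<noteq> {}" if K: "K \<in> topspace ?E" for K
  proof -
    have sub: "K \<subseteq> topspace X" and "K \<noteq> {}"
      using K by (simp_all add: topspace_expc_space[OF X] subcontinuum_def)
    then obtain x where x: "x \<in> K" by auto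
    have "z = x" if "z \<in> topspace X" for z using deg that x sub unfolding nondegenerate_def by (metis subsetD)
    then show "K = topspace X" using x sub by (metis subsetI subset_antisym)
    show "topspace X \<noteq> {}" using x sub by auto
  qed
  obtain \<B> where B: "base_of X \<B>" "weight X = |\<B>|" by (rule weight_base)
  \<comment> \<open>Open sets of a space with at most one point are its whole carrier as soon as they contain a point.\<close>
  define \<M> :: "'a set set set" where "\<M> = (if topspace ?E = {} then {} else {UNIV})"
  show "hereditary_lindelof_number ?E \<le>o weight X"
    unfolding B(2)
  proof (rule hereditary_lindelof_number_le_network)
    show "|\<M>| \<le>o |\<B>|"
    proof (cases "topspace ?E = {}")
      case False
      then obtain K where "K \<in> topspace ?E" by blast
      then obtain x where "x \<in> topspace X" using single(2) by blast
      then have "\<B> \<noteq> {}" using B(1) openin_topspace[of X] unfolding base_of_iff by fastforce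
      then show ?thesis using False by (simp add: \<M>_def card_of_singl_ordLeq)
    qed (simp add: \<M>_def card_of_empty)
    fix W K assume "openin ?E W" "K \<in> W"
    then have K: "K \<in> topspace ?E" using openin_subset by blast
    have "topspace ?E \<subseteq> W"
    proof
      fix L assume "L \<in> topspace ?E"
      then have "L = K" using single(1)[of L] single(1)[OF K] by simp
      then show "L \<in> W" using \<open>K \<in> W\<close> by simp
    qed
    then show "\<exists>M\<in>\<M>. K \<in> M \<and> topspace ?E \<inter> M \<subseteq> W" using K by (auto simp: \<M>_def)
  qed
qed

theorem theorem5:
  fixes X :: "'a topology"
  assumes "continuum X" and "Sln X <o ctwo ^c natLeq"
  shows "covering_dim X \<le> 1 \<and>
         rim_weight X \<le>o Sln X \<and>
         Sln X \<le>o hereditary_lindelof_number (expc_space X) \<and>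
         hereditary_lindelof_number (expc_space X) \<le>o weight X \<and>
         weight X \<le>o cardSuc (Sln X)"
proof -
  have "covering_dim X \<le> 1"
    unfolding covering_dim_def
  proof (rule Inf_lower)
    have "covering_dim_le X 1" by (rule covering_dim_le_1[OF assms])
    then show "1 \<in> {ereal (of_int n) |n. - 1 \<le> n \<and> covering_dim_le X n}"
      by (auto intro!: exI[of _ 1] simp: one_ereal_def)
  qed
  then show ?thesis
    using degenerate_case[OF assms(1)] rim_weight_le_Sln[OF assms(1) _ assms(2)]
      Sln_le_hereditary_lindelof_expc[OF assms(1) _ assms(2)] hereditary_lindelof_expc_le_weight[OF assms(1)]
      weight_le_cardSuc_Sln[OF assms(1)] by (cases "nondegenerate (topspace X)") simp_all
qed

end
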